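(* If $A,B\subset\{1,\ldots,N\}$ with both $c_1\alpha N\leq |A|\leq |B|\leq c_2\alpha N$ then $A+B$ contains an arithmetic progression of length at least \[\exp\left(c f(\alpha)\sqrt{\log N}\right),\] where $f(\alpha)=\alpha^{1/2}/\log(1/\alpha)$ and the constant $c>0$ depends only on $c_1$ and $c_2$.
   Context: $N$ is a positive integer, $c_1,c_2>0$ are constants, and $\alpha>0$ is a parameter measuring the common order of magnitude of the densities of $A$ and $B$ in $\{1,\ldots,N\}$. $A+B=\{a+b: a\in A, b\in B\}$. $\log$ is the natural logarithm.
   Formalization: Proved for α ≤ α0 with any fixed α0 < 1 (c then also depends on α0), since f(α) → ∞ as α → 1 makes the bound exceed |A+B|; and for |B| ≥ 2, since if |A| = |B| = 1 then A+B is one point and has no progression of length greater than 1. *)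

theory Defs
  imports Complex_Main "HOL-Library.Set_Algebras"
begin

(* The common difference is nonzero. As progressions here live in nat, and a
   decreasing one can be read backwards, positive differences suffice.
   A one-point set has no progression of length > 1, so a lower bound > 1 on the
   length, however close to 1, requires card (A + B) >= 2. *)
definition arith_progression :: "nat \<Rightarrow> nat set \<Rightarrow> bool" where
  "arith_progression k P \<longleftrightarrow> (\<exists>a d. 0 < d \<and> P = (\<lambda>i. a + i * d) ` {..<k})"

(* Tends to infinity as \<alpha> increases to 1, and has no meaning at \<alpha> = 1 (where
   HOL's x / 0 = 0 would give 0). No constant c works uniformly for \<alpha> near 1:
   for A = B = {1..N} the bound would exceed card (A + B) = 2 * N - 1. Results
   uniform in \<alpha> are therefore stated for \<alpha> \<le> \<alpha>0 with a fixed \<alpha>0 < 1. *)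
definition density_factor :: "real \<Rightarrow> real" where
  "density_factor \<alpha> = \<alpha> powr (1/2) / ln (1 / \<alpha>)"

end

theory Submission
  imports Defs "HOL-Analysis.Analysis"
begin

text \<open>
  Embed \<open>A\<close> and \<open>B\<close> in \<open>\<int> / M\<close> with \<open>M = 4 N\<close>, and let \<open>f x\<close> be the proportion of the \<open>y \<in> A\<close> with
  \<open>x - y \<in> B\<close>; it is positive exactly on \<open>A + B\<close>. The average of \<open>f\<close> over \<open>k\<close> random elements of
  \<open>A\<close>, as in the Croot--Sisask sampling method, suggests a reversible random walk on \<open>\<int> / M\<close>: choose
  \<open>u \<in> A ^ k\<close> uniformly, then a uniform \<open>s\<close> among those with \<open>u + s \<in> A ^ k\<close>, and step by \<open>s\<close>.
  Comparing the sampled value of \<open>f\<close> before and after each step bounds an exponential moment of the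
  change of \<open>f\<close> along the whole walk, so that \<open>m\<close> steps started from a distribution of density
  at most \<open>l\<close> on the zeros of \<open>f\<close> reach a mean of at most \<open>2 m ln l / k\<close>. Gaining from the
  whole walk, rather than adding up \<open>m\<close> errors, is what saves a logarithm.

  On the other hand the transform of the step distribution is nonnegative, and by a Chang type
  inequality the characters where it exceeds \<open>1/2\<close> are spanned by \<open>O(k ln (M / |A|))\<close> of them.
  Hence after \<open>m \<approx> ln (1 / \<alpha>)\<close> steps \<open>f\<close> is almost invariant under a progression of length \<open>l\<close> given
  by Dirichlet's theorem. If each translate of this progression met the complement of \<open>A + B\<close>, the
  smoothed \<open>f\<close> would be small on average, contradicting that its mean is \<open>|B| / M\<close>.
  Lengths \<open>l \<le> 1 / \<alpha>\<close>, for which the precision needed in Dirichlet's theorem is too costly, are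
  covered by a pigeonhole argument on differences of popular summands.
\<close>

section \<open>Characters of a cyclic group\<close>

text \<open>The Taylor series are compared term by term; this reduces to
  \<open>2 ^ n * fact n \<le> fact (2 * n)\<close>.\<close>

lemma cosh_le_exp_half_square: "cosh r \<le> exp (r\<^sup>2 / 2)" for r :: real
proof -
  have f: "(\<lambda>n. r ^ (2 * n) / fact (2 * n)) sums cosh r"
  proof -
    have "(\<lambda>n. if even n then r ^ n /\<^sub>R fact n else 0) sums cosh r"
      by (rule cosh_converges)
    then have "(\<lambda>n. (if even (2 * n) then r ^ (2 * n) /\<^sub>R fact (2 * n) else 0)) sums cosh r"
      by (subst sums_mono_reindex[of "\<lambda>n. 2 * n"]) (auto simp: strict_mono_def elim!: oddE)
    then show ?thesis by (simp add: field_simps)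
  qed
  have g: "(\<lambda>n. (r\<^sup>2 / 2) ^ n / fact n) sums exp (r\<^sup>2 / 2)"
    using exp_converges[of "r\<^sup>2 / 2"] by (simp add: field_simps)
  have "r ^ (2 * n) / fact (2 * n) \<le> (r\<^sup>2 / 2) ^ n / fact n" for n
  proof -
    have "(2::real) ^ n * fact n \<le> fact (2 * n)"
    proof (induction n)
      case (Suc n)
      have "(2::real) ^ Suc n * fact (Suc n) = (2 * (1 + real n)) * (2 ^ n * fact n)" by simp
      also have "\<dots> \<le> (2 * (1 + real n)) * fact (2 * n)"
        using Suc by (intro mult_left_mono) auto
      also have "\<dots> \<le> (2 * (1 + real n)) * ((1 + 2 * real n) * fact (2 * n))"
        by (intro mult_left_mono) auto
      also have "\<dots> = fact (2 * Suc n)" by (simp add: field_simps)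
      finally show ?case .
    qed simp
    then have "r ^ (2 * n) / fact (2 * n) \<le> r ^ (2 * n) / (2 ^ n * fact n)"
      by (intro divide_left_mono) (auto simp: power_mult)
    then show ?thesis by (simp add: power_divide power_mult)
  qed
  then show ?thesis using f g by (rule sums_le)
qed

text \<open>On the segment between \<open>-r\<close> and \<open>r\<close> the convex function exp
  lies below its chord, and the chord at \<open>r * y\<close> is the right-hand side.\<close>

lemma exp_mult_le_cosh_sinh:
  fixes r y :: real
  assumes "\<bar>y\<bar> \<le> 1"
  shows "exp (r * y) \<le> cosh r + y * sinh r"
proof -
  have "exp ((1 - (1 + y) / 2) *\<^sub>R (- r) + ((1 + y) / 2) *\<^sub>R r)
      \<le> (1 - (1 + y) / 2) * exp (- r) + ((1 + y) / 2) * exp r"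
    using assms by (intro convex_onD[OF exp_convex]) auto
  then show ?thesis
    by (simp add: cosh_def sinh_def field_simps)
qed

text \<open>Jensen's inequality for the uniform distribution on \<open>T\<close>.\<close>

lemma exp_average_le:
  fixes h :: "'a \<Rightarrow> real"
  assumes "finite T" "T \<noteq> {}"
  shows "exp ((\<Sum>x\<in>T. h x) / card T) \<le> (\<Sum>x\<in>T. exp (h x)) / card T"
proof -
  have "exp (\<Sum>x\<in>T. (1 / card T) *\<^sub>R h x) \<le> (\<Sum>x\<in>T. (1 / card T) * exp (h x))"
    using assms by (intro convex_on_sum[OF _ _ exp_convex]) auto
  then show ?thesis by (simp add: sum_divide_distrib)
qed

section \<open>Additive characters modulo \<open>M\<close> and their orthogonality\<close>

locale cyclic_modulus =
  fixes M :: int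
  assumes M_pos: "0 < M"
begin

abbreviation "Z \<equiv> {0..<M}"

text \<open>Both arguments are arbitrary integers, not residues in \<open>Z\<close>; periodicity
  modulo \<open>M\<close> is proved, so frequencies and points can be added without
  reduction.\<close>

definition chi :: "int \<Rightarrow> int \<Rightarrow> complex" where
  "chi g x = cis (2 * pi * of_int (g * x) / of_int M)"

lemma chi_add: "chi g (x + y) = chi g x * chi g y"
  by (simp add: chi_def cis_mult ring_distribs add_divide_distrib)

lemma chi_add_left: "chi (g + h) x = chi g x * chi h x"
  by (simp add: chi_def cis_mult ring_distribs add_divide_distrib)

lemma chi_minus: "chi g (- x) = cnj (chi g x)"
  by (simp add: chi_def cis_cnj)

lemma chi_minus_left: "chi (- g) x = cnj (chi g x)"
  by (simp add: chi_def cis_cnj)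

lemma chi_commute: "chi g x = chi x g"
  by (simp add: chi_def mult.commute)

lemma norm_chi [simp]: "norm (chi g x) = 1"
  by (simp add: chi_def)

lemma chi_0 [simp]: "chi g 0 = 1" "chi 0 x = 1"
  by (auto simp: chi_def)

lemma chi_dvd: "M dvd g \<Longrightarrow> chi g x = 1"
proof -
  assume "M dvd g"
  then obtain k where "g = M * k" by auto
  then have "chi g x = cis (2 * pi * of_int (k * x))"
    using M_pos by (simp add: chi_def mult.assoc)
  then show ?thesis by (simp only: cis_multiple_2pi[OF Ints_of_int])
qed

lemma chi_eq_1_imp_dvd: "chi g 1 = 1 \<Longrightarrow> M dvd g"
proof -
  assume "chi g 1 = 1"
  then have "cos (2 * pi * of_int g / of_int M) = 1"
    by (simp add: chi_def complex_eq_iff)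
  then obtain n :: int where "2 * pi * of_int g / of_int M = of_int n * 2 * pi"
    by (auto simp: cos_one_2pi_int)
  then have "of_int g = (of_int (n * M) :: real)"
    using M_pos by (simp add: field_simps)
  then have "g = n * M" by (simp only: of_int_eq_iff)
  then show "M dvd g" by simp
qed

lemma chi_mod [simp]: "chi g (x mod M) = chi g x"
proof -
  have "chi g x = chi g (x mod M + M * (x div M))" by simp
  also have "\<dots> = chi g (x mod M) * chi (M * (x div M)) g"
    unfolding chi_add by (simp add: chi_commute)
  finally show ?thesis by (simp add: chi_dvd)
qed

lemma chi_sum_left: "finite L \<Longrightarrow> chi (\<Sum>g\<in>L. h g) x = (\<Prod>g\<in>L. chi (h g) x)"
  by (induction L rule: finite_induct) (auto simp: chi_add_left)

text \<open>Functions on the cyclic group are modelled as functions on \<open>int\<close> that agree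
  with their value at \<open>x mod M\<close>; for these, translation permutes the residues.\<close>

lemma sum_shift:
  fixes g :: "int \<Rightarrow> 'b::comm_monoid_add"
  assumes "\<And>x. g (x mod M) = g x"
  shows "(\<Sum>x\<in>Z. g (x + s)) = (\<Sum>x\<in>Z. g x)"
  by (rule sum.reindex_bij_witness[of _ "\<lambda>x. (x - s) mod M" "\<lambda>x. (x + s) mod M"])
     (use M_pos assms in \<open>auto simp: mod_simps\<close>)

text \<open>Translation by 1 multiplies the sum by \<open>chi g 1\<close>, which equals 1 only if
  \<open>M\<close> divides \<open>g\<close>.\<close>

lemma sum_chi: "(\<Sum>x\<in>Z. chi g x) = (if M dvd g then of_int M else 0)"
proof (cases "M dvd g")
  case True
  then show ?thesis using M_pos by (simp add: chi_dvd)
next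
  case False
  have "(\<Sum>x\<in>Z. chi g x) = (\<Sum>x\<in>Z. chi g (x + 1))"
    by (rule sum_shift[symmetric]) simp
  also have "\<dots> = (\<Sum>x\<in>Z. chi g x) * chi g 1"
    by (simp add: chi_add sum_distrib_right)
  finally have "(\<Sum>x\<in>Z. chi g x) * (1 - chi g 1) = 0" by (simp add: algebra_simps)
  then show ?thesis using False chi_eq_1_imp_dvd by auto
qed

section \<open>Dissociated sets, Riesz products and Chang's inequality\<close>

definition dissociated :: "int set \<Rightarrow> bool" where
  "dissociated L \<longleftrightarrow> (\<forall>e. (\<forall>g\<in>L. e g \<in> {-1, 0, 1}) \<longrightarrow> M dvd (\<Sum>g\<in>L. e g * g) \<longrightarrow> (\<forall>g\<in>L. e g = 0))"

text \<open>The product expands into characters at the frequencies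
  \<open>\<Sum>g\<in>L. e g * g\<close> with \<open>e g\<close> in {-1, 0, 1}. Dissociativity makes
  all of them nonzero modulo \<open>M\<close> except for \<open>e = 0\<close>, so only the constant
  term survives summation.\<close>

lemma sum_Riesz_product:
  fixes p :: "int \<Rightarrow> real" and w :: "int \<Rightarrow> complex"
  assumes fin: "finite L" and diss: "dissociated L"
  shows "(\<Sum>x\<in>Z. \<Prod>g\<in>L. p g + Re (w g * chi g x)) = of_int M * (\<Prod>g\<in>L. p g)"
proof -
  \<comment> \<open>\<open>k g e\<close> is the coefficient of \<open>chi (e * g)\<close> in the
    factor of \<open>g\<close>, read off from Re z = (z + cnj z) / 2.\<close>
  define k where "k g e = (if e = 0 then of_real (p g) else if e = 1 then w g / 2 else cnj (w g) / 2)"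
    for g e :: int
  let ?E = "PiE L (\<lambda>_. {-1, 0, 1 :: int})"
  have expand: "complex_of_real (p g + Re (w g * chi g x)) = (\<Sum>e\<in>{-1, 0, 1}. k g e * chi (e * g) x)" for g x
  proof -
    have "complex_of_real (p g + Re z) = p g + z / 2 + cnj z / 2" for z :: complex
      by (simp add: complex_eq_iff)
    from this[of "w g * chi g x"] show ?thesis by (simp only: k_def) (simp add: chi_minus_left)
  qed
  have "complex_of_real (\<Sum>x\<in>Z. \<Prod>g\<in>L. p g + Re (w g * chi g x))
      = (\<Sum>x\<in>Z. \<Prod>g\<in>L. \<Sum>e\<in>{-1, 0, 1}. k g e * chi (e * g) x)"
    by (simp only: of_real_sum of_real_prod expand)
  also have "\<dots> = (\<Sum>x\<in>Z. \<Sum>e\<in>?E. \<Prod>g\<in>L. k g (e g) * chi (e g * g) x)"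
    using fin by (subst prod_sum_PiE) auto
  also have "\<dots> = (\<Sum>e\<in>?E. \<Sum>x\<in>Z. (\<Prod>g\<in>L. k g (e g)) * chi (\<Sum>g\<in>L. e g * g) x)"
    by (subst sum.swap) (simp add: prod.distrib chi_sum_left fin)
  also have "\<dots> = (\<Sum>e\<in>?E. if e = (\<lambda>g\<in>L. 0) then of_int M * (\<Prod>g\<in>L. of_real (p g)) else 0)"
  proof (rule sum.cong)
    fix e assume e: "e \<in> ?E"
    show "(\<Sum>x\<in>Z. (\<Prod>g\<in>L. k g (e g)) * chi (\<Sum>g\<in>L. e g * g) x)
        = (if e = (\<lambda>g\<in>L. 0) then of_int M * (\<Prod>g\<in>L. of_real (p g)) else 0)"
    proof (cases "e = (\<lambda>g\<in>L. 0)")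
      case True
      then show ?thesis using M_pos by (simp add: k_def)
    next
      case False
      then have "\<not> (\<forall>g\<in>L. e g = 0)" using e by (auto simp: PiE_def extensional_def)
      moreover have "\<forall>g\<in>L. e g \<in> {-1, 0, 1}" using e by (auto simp: PiE_def)
      ultimately have "\<not> M dvd (\<Sum>g\<in>L. e g * g)" using diss unfolding dissociated_def by blast
      then show ?thesis using False by (simp add: sum_chi flip: sum_distrib_left)
    qed
  qed simp
  also have "\<dots> = of_int M * (\<Prod>g\<in>L. of_real (p g))"
    using fin by (subst sum.delta) (auto simp: finite_PiE)
  finally have "complex_of_real (\<Sum>x\<in>Z. \<Prod>g\<in>L. p g + Re (w g * chi g x))
      = complex_of_real (of_int M * (\<Prod>g\<in>L. p g))" by simp
  then show ?thesis by (simp only: of_real_eq_iff)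
qed

text \<open>On a dissociated set the characters behave like independent variables: the chord bound
  replaces each exponential factor by one that is affine in a real part, and the product of these is
  a Riesz product whose sum is exact.\<close>

lemma Rudin:
  assumes fin: "finite L" and diss: "dissociated L"
  shows "(\<Sum>x\<in>Z. exp (\<Sum>g\<in>L. Re (c g * chi g x))) \<le> of_int M * exp ((\<Sum>g\<in>L. (norm (c g))\<^sup>2) / 2)"
proof -
  \<comment> \<open>The phase \<open>sgn (c g)\<close> brings the real part into [-1, 1], where the
    chord bound applies; \<open>sinh\<close> is the slope of the chord.\<close>
  let ?w = "\<lambda>g. of_real (sinh (norm (c g))) * sgn (c g)"
  have "exp (Re (c g * chi g x)) \<le> cosh (norm (c g)) + Re (?w g * chi g x)" for g x
  proof -
    have "norm (sgn (c g) * chi g x) \<le> 1" by (simp add: norm_mult norm_sgn)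
    then have "\<bar>Re (sgn (c g) * chi g x)\<bar> \<le> 1" using abs_Re_le_cmod order_trans by blast
    then have "exp (norm (c g) * Re (sgn (c g) * chi g x))
        \<le> cosh (norm (c g)) + Re (sgn (c g) * chi g x) * sinh (norm (c g))"
      by (rule exp_mult_le_cosh_sinh)
    moreover have "norm (c g) * Re (sgn (c g) * chi g x) = Re (c g * chi g x)"
    proof -
      have "c g = norm (c g) *\<^sub>R sgn (c g)" by (cases "c g = 0") (simp_all add: sgn_div_norm)
      then have "Re (c g * chi g x) = Re (norm (c g) *\<^sub>R (sgn (c g) * chi g x))"
        by (metis mult_scaleR_left)
      then show ?thesis by simp
    qed
    moreover have "Re (?w g * chi g x) = Re (sgn (c g) * chi g x) * sinh (norm (c g))"
    proof -
      have "?w g * chi g x = of_real (sinh (norm (c g))) * (sgn (c g) * chi g x)"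
        by (simp only: mult.assoc)
      then show ?thesis by (simp only: scaleR_conv_of_real[symmetric] scaleR_complex.sel mult.commute)
    qed
    ultimately show ?thesis by simp
  qed
  then have "(\<Sum>x\<in>Z. exp (\<Sum>g\<in>L. Re (c g * chi g x)))
      \<le> (\<Sum>x\<in>Z. \<Prod>g\<in>L. cosh (norm (c g)) + Re (?w g * chi g x))"
    by (intro sum_mono) (auto simp: exp_sum fin intro!: prod_mono)
  also have "\<dots> = of_int M * (\<Prod>g\<in>L. cosh (norm (c g)))"
    by (rule sum_Riesz_product[OF fin diss])
  also have "\<dots> \<le> of_int M * (\<Prod>g\<in>L. exp ((norm (c g))\<^sup>2 / 2))"
    using M_pos by (intro mult_left_mono prod_mono) (auto intro: cosh_le_exp_half_square)
  also have "\<dots> = of_int M * exp ((\<Sum>g\<in>L. (norm (c g))\<^sup>2) / 2)"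
    by (simp add: exp_sum fin sum_divide_distrib)
  finally show ?thesis .
qed

text \<open>Duality with Rudin's inequality: the trigonometric polynomial \<open>?h\<close> built
  from the coefficients of \<open>T\<close> has mean exactly \<open>?S\<close> on \<open>T\<close>,
  while its exponential sum over \<open>Z\<close> is at most \<open>M * exp (?S / 2)\<close>. Jensen
  on \<open>T\<close> compares the two.\<close>

lemma Chang:
  assumes fin: "finite L" and diss: "dissociated L" and T: "T \<subseteq> Z" "T \<noteq> {}"
  shows "(\<Sum>g\<in>L. (norm ((\<Sum>x\<in>T. chi g x) / card T))\<^sup>2) \<le> 2 * ln (of_int M / card T)"
proof -
  define c where "c g = (\<Sum>x\<in>T. chi g x) / card T" for g
  let ?S = "\<Sum>g\<in>L. (norm (c g))\<^sup>2"
  let ?h = "\<lambda>x. \<Sum>g\<in>L. Re (cnj (c g) * chi g x)"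
  have finT: "finite T" using T finite_subset by auto
  then have cT: "card T > 0" using T by (simp add: card_gt_0_iff)
  have "(\<Sum>x\<in>T. ?h x) / card T = (\<Sum>g\<in>L. Re (cnj (c g) * c g))"
  proof -
    have "(\<Sum>x\<in>T. ?h x) = (\<Sum>g\<in>L. Re (cnj (c g) * (\<Sum>x\<in>T. chi g x)))"
      by (subst sum.swap) (simp add: sum_distrib_left Re_sum)
    also have "\<dots> = (\<Sum>g\<in>L. card T * Re (cnj (c g) * c g))"
      using cT by (intro sum.cong) (auto simp: c_def)
    finally show ?thesis using cT by (simp flip: sum_distrib_left)
  qed
  also have "\<dots> = ?S"
    by (intro sum.cong refl) (metis Re_complex_of_real complex_norm_square mult.commute)
  finally have avg: "(\<Sum>x\<in>T. ?h x) / card T = ?S" .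
  have "exp ?S \<le> (\<Sum>x\<in>T. exp (?h x)) / card T"
    using exp_average_le[OF finT T(2), of ?h] by (simp only: avg)
  also have "\<dots> \<le> (\<Sum>x\<in>Z. exp (?h x)) / card T"
    using T by (intro divide_right_mono sum_mono2) auto
  also have "\<dots> \<le> of_int M * exp (?S / 2) / card T"
    using Rudin[OF fin diss, of "\<lambda>g. cnj (c g)"] by (intro divide_right_mono) auto
  finally have "exp (?S / 2) * exp (?S / 2) \<le> (of_int M / card T) * exp (?S / 2)"
    by (simp flip: exp_add)
  then have "exp (?S / 2) \<le> of_int M / card T"
    by (rule mult_right_le_imp_le) simp
  then have "?S / 2 \<le> ln (of_int M / card T)"
    using cT M_pos by (subst ln_ge_iff) auto
  then show ?thesis by (simp add: c_def)
qed

text \<open>A maximal dissociated subset works: adjoining any further \<open>g\<close> creates a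
  relation with coefficients in {-1, 0, 1}, which can be solved for \<open>g\<close>.\<close>

lemma dissociated_span:
  assumes "finite X"
  obtains L where "L \<subseteq> X" "dissociated L"
    "\<And>g. g \<in> X \<Longrightarrow> \<exists>e. (\<forall>h\<in>L. e h \<in> {-1, 0, 1}) \<and> M dvd (g - (\<Sum>h\<in>L. e h * h))"
proof -
  let ?F = "{L. L \<subseteq> X \<and> dissociated L}"
  have "finite ?F" using assms by simp
  moreover have "{} \<in> ?F" by (auto simp: dissociated_def)
  ultimately have "\<exists>L\<in>?F. {} \<subseteq> L \<and> (\<forall>L'\<in>?F. L \<subseteq> L' \<longrightarrow> L = L')"
    by (rule finite_has_maximal2)
  then obtain L where L: "L \<subseteq> X" "dissociated L"
    and max: "\<forall>L'\<in>?F. L \<subseteq> L' \<longrightarrow> L = L'"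
    by auto
  have finL: "finite L" using L assms finite_subset by blast
  have "\<exists>e. (\<forall>h\<in>L. e h \<in> {-1, 0, 1}) \<and> M dvd (g - (\<Sum>h\<in>L. e h * h))" if g: "g \<in> X" for g
  proof (cases "g \<in> L")
    case True
    then have "(\<Sum>h\<in>L. (if h = g then 1 else 0) * h) = g"
      using finL by (subst sum.cong[OF refl, of _ _ "\<lambda>h. if h = g then g else 0"]) auto
    then show ?thesis
      by (intro exI[of _ "\<lambda>h. if h = g then 1 else 0"]) auto
  next
    case False
    then have "\<not> dissociated (insert g L)" using max g L(1) by blast
    then obtain e where e: "\<forall>h\<in>insert g L. e h \<in> {-1, 0, 1}" "M dvd (\<Sum>h\<in>insert g L. e h * h)"
      and ne: "\<not> (\<forall>h\<in>insert g L. e h = 0)"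
      unfolding dissociated_def by blast
    have s: "M dvd (e g * g + (\<Sum>h\<in>L. e h * h))" using e(2) False finL by simp
    \<comment> \<open>Otherwise the relation would live on \<open>L\<close> alone, and
      dissociativity of \<open>L\<close> would make it trivial.\<close>
    have "e g \<noteq> 0"
    proof
      assume "e g = 0"
      then have "\<forall>h\<in>L. e h = 0" using L(2) e(1) s unfolding dissociated_def by auto
      with \<open>e g = 0\<close> ne show False by auto
    qed
    then consider "e g = 1" | "e g = -1" using e(1) by auto
    then show ?thesis
    proof cases
      case 1
      then show ?thesis using s e(1) by (intro exI[of _ "\<lambda>h. - e h"]) (auto simp: sum_negf)
    next
      case 2
      then have "M dvd - (- g + (\<Sum>h\<in>L. e h * h))" using s dvd_minus_iff by fastforce
      then show ?thesis using e(1) by (intro exI[of _ e]) (auto simp: algebra_simps)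
    qed
  qed
  then show ?thesis by (rule that[OF L])
qed

end

section \<open>The random walk attached to a translation action\<close>

text \<open>Abstracts the diagonal translation of tuples: later \<open>U\<close> is the set of
  \<open>k\<close>-tuples of residues and \<open>S\<close> the tuples from \<open>A\<close>. The
  walk only needs a finite set \<open>U\<close> with an action of the cyclic group and a nonempty
  subset \<open>S\<close>.\<close>

locale translation_action = cyclic_modulus M for M :: int +
  fixes act :: "int \<Rightarrow> 'u \<Rightarrow> 'u" and U S :: "'u set"
  assumes finite_U: "finite U" and S_subset: "S \<subseteq> U" and S_nonempty: "S \<noteq> {}"
    and act_in: "u \<in> U \<Longrightarrow> act s u \<in> U"
    and act_act: "u \<in> U \<Longrightarrow> act s (act t u) = act (s + t) u"
    and act_0: "u \<in> U \<Longrightarrow> act 0 u = u"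
    and act_mod: "u \<in> U \<Longrightarrow> act (s mod M) u = act s u"
begin

lemma finite_S: "finite S"
  using finite_U S_subset finite_subset by blast

lemma card_S_pos: "0 < card S"
  using finite_S S_nonempty by (simp add: card_gt_0_iff)

definition T :: "'u \<Rightarrow> int set" where
  "T u = {s \<in> Z. act s u \<in> S}"

lemma T_subset: "T u \<subseteq> Z" by (auto simp: T_def)

lemma finite_T [simp]: "finite (T u)"
  using T_subset by (rule finite_subset) simp

lemma zero_in_T: "u \<in> S \<Longrightarrow> 0 \<in> T u"
  using M_pos S_subset act_0 by (auto simp: T_def)

lemma card_T_pos: "u \<in> S \<Longrightarrow> 0 < card (T u)"
  using zero_in_T by (auto simp: card_gt_0_iff)

lemma mod_in_T: "u \<in> U \<Longrightarrow> s mod M \<in> T u \<longleftrightarrow> act s u \<in> S"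
  using M_pos by (simp add: T_def act_mod)

lemma act_mod_add: "u \<in> U \<Longrightarrow> act (s mod M + t) u = act (s + t) u"
  using act_mod[of u "s mod M + t"] act_mod[of u "s + t"] by (simp add: mod_simps)

lemma act_mod_minus: "u \<in> U \<Longrightarrow> act ((- s) mod M) (act s u) = u"
  by (simp add: act_mod act_in act_act act_0 act_mod_add)

text \<open>\<open>T (act t u)\<close> is the translate of \<open>T u\<close> by \<open>-t\<close>
  modulo \<open>M\<close>.\<close>

lemma sum_T_act:
  fixes h :: "int \<Rightarrow> 'b::comm_monoid_add"
  assumes u: "u \<in> U" and h: "\<And>s. h (s mod M) = h s"
  shows "(\<Sum>s\<in>T (act t u). h (s + t)) = (\<Sum>s\<in>T u. h s)"
  by (rule sum.reindex_bij_witness[of _ "\<lambda>s. (s - t) mod M" "\<lambda>s. (s + t) mod M"])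
     (use M_pos u h in \<open>auto simp: mod_simps mod_in_T act_in act_act T_def act_mod act_mod_add\<close>)

lemma card_T_act: "u \<in> U \<Longrightarrow> card (T (act t u)) = card (T u)"
  using sum_T_act[of u "\<lambda>_. 1::nat" t] by simp

text \<open>The uniform distribution on \<open>S\<close> is stationary: \<open>(u, s)\<close> maps
  to \<open>(act s u, - s mod M)\<close> under an involution of the admissible pairs, and this keeps
  the weight because \<open>card (T u)\<close> is constant along orbits.\<close>

lemma reversal:
  fixes H :: "'u \<Rightarrow> 'b::real_normed_field"
  shows "(\<Sum>u\<in>S. (\<Sum>s\<in>T u. H (act s u)) / of_nat (card (T u))) = (\<Sum>u\<in>S. H u)"
proof -
  define r where "r = (\<lambda>(u, s). (act s u, (- s) mod M))"
  have "(\<Sum>u\<in>S. (\<Sum>s\<in>T u. H (act s u)) / of_nat (card (T u)))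
      = (\<Sum>(u, s)\<in>Sigma S T. H (act s u) / of_nat (card (T u)))"
    by (simp add: sum.Sigma finite_S sum_divide_distrib)
  also have "\<dots> = (\<Sum>(u, s)\<in>Sigma S T. H u / of_nat (card (T u)))"
  proof (rule sum.reindex_bij_witness[of _ r r])
    fix p assume p: "p \<in> Sigma S T"
    then obtain u s where [simp]: "p = (u, s)" and u: "u \<in> S" "u \<in> U" and s: "s \<in> Z" "act s u \<in> S"
      using S_subset by (auto simp: T_def)
    show "r (r p) = p" "r (r p) = p"
      using s by (simp_all add: r_def act_mod_minus u mod_simps)
    show "r p \<in> Sigma S T" "r p \<in> Sigma S T"
      using u s by (auto simp: r_def mod_in_T act_in act_act act_0)
    show "(case r p of (u, s) \<Rightarrow> H u / of_nat (card (T u)))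
        = (case p of (u, s) \<Rightarrow> H (act s u) / of_nat (card (T u)))"
      using u by (simp add: r_def card_T_act)
  qed
  also have "\<dots> = (\<Sum>u\<in>S. \<Sum>s\<in>T u. H u / of_nat (card (T u)))"
    by (subst sum.Sigma) (simp_all add: finite_S)
  also have "\<dots> = (\<Sum>u\<in>S. H u)"
    using zero_in_T by (intro sum.cong) auto
  finally show ?thesis .
qed

text \<open>The involution of \<open>reversal\<close> is applied to all pairs in
  \<open>S \<times> Z\<close>, whose endpoint may leave \<open>S\<close>. Seen from the endpoint
  \<open>v\<close>, the weights \<open>1 / card (T v)\<close> add up to 1, or to 0 when
  \<open>T v\<close> is empty.\<close>

lemma sum_inverse_card_T: "(\<Sum>u\<in>S. of_int M / card (T u)) \<le> card U"
proof -
  define r where "r = (\<lambda>(u, s). (act s u, (- s) mod M))"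
  have "(\<Sum>u\<in>S. of_int M / card (T u)) = (\<Sum>(u, s)\<in>S \<times> Z. 1 / real (card (T u)))"
    using M_pos by (simp add: sum.Sigma[symmetric] finite_S)
  also have "\<dots> = (\<Sum>(v, s)\<in>Sigma U T. 1 / real (card (T v)))"
  proof (rule sum.reindex_bij_witness[of _ r r])
    fix p assume "p \<in> S \<times> Z"
    then obtain u s where [simp]: "p = (u, s)" and u: "u \<in> S" "u \<in> U" and s: "s \<in> Z"
      using S_subset by auto
    show "r (r p) = p"
      using s by (simp add: r_def act_mod_minus u mod_simps)
    show "r p \<in> Sigma U T"
      using u s by (auto simp: r_def mod_in_T act_in act_act act_0)
    show "(case r p of (v, s) \<Rightarrow> 1 / real (card (T v)))
        = (case p of (u, s) \<Rightarrow> 1 / real (card (T u)))"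
      using u by (simp add: r_def card_T_act)
  next
    fix p assume "p \<in> Sigma U T"
    then obtain u s where [simp]: "p = (u, s)" and u: "u \<in> U" and s: "s \<in> Z" "act s u \<in> S"
      by (auto simp: T_def)
    show "r (r p) = p"
      using s by (simp add: r_def act_mod_minus u mod_simps)
    show "r p \<in> S \<times> Z"
      using u s M_pos by (auto simp: r_def)
  qed
  also have "\<dots> = (\<Sum>v\<in>U. \<Sum>s\<in>T v. 1 / real (card (T v)))"
    by (subst sum.Sigma) (simp_all add: finite_U)
  also have "\<dots> \<le> (\<Sum>v\<in>U. 1)"
    by (intro sum_mono) (simp add: divide_simps)
  finally show ?thesis by simp
qed

section \<open>The step distribution and its nonnegative transform\<close>

text \<open>The law of the step \<open>s\<close> when \<open>u\<close> is uniform in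
  \<open>S\<close> and then \<open>s\<close> is uniform in \<open>T u\<close>.\<close>

definition nu :: "int \<Rightarrow> real" where
  "nu s = (\<Sum>u\<in>S. if s \<in> T u then 1 / card (T u) else 0) / card S"

lemma sum_nu:
  fixes h :: "int \<Rightarrow> 'b::real_normed_field"
  shows "(\<Sum>s\<in>Z. of_real (nu s) * h s) = (\<Sum>u\<in>S. (\<Sum>s\<in>T u. h s) / of_nat (card (T u))) / of_nat (card S)"
proof -
  have "(\<Sum>s\<in>Z. of_real (nu s) * h s)
      = (\<Sum>s\<in>Z. \<Sum>u\<in>S. if s \<in> T u then h s / of_nat (card (T u)) / of_nat (card S) else 0)"
    by (auto simp: nu_def sum_divide_distrib sum_distrib_right intro!: sum.cong)
  also have "\<dots> = (\<Sum>u\<in>S. \<Sum>s\<in>Z. if s \<in> T u then h s / of_nat (card (T u)) / of_nat (card S) else 0)"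
    by (rule sum.swap)
  also have "\<dots> = (\<Sum>u\<in>S. \<Sum>s\<in>T u. h s / of_nat (card (T u)) / of_nat (card S))"
    using T_subset by (simp add: sum.If_cases Int_absorb1)
  finally show ?thesis by (simp add: sum_divide_distrib)
qed

lemma nu_nonneg: "0 \<le> nu s"
  by (auto simp: nu_def intro!: divide_nonneg_nonneg sum_nonneg)

lemma nu_sum: "(\<Sum>s\<in>Z. nu s) = 1"
proof -
  have "(\<Sum>u\<in>S. (\<Sum>s\<in>T u. 1) / real (card (T u))) = (\<Sum>u\<in>S. 1)"
    using zero_in_T by (intro sum.cong) auto
  then show ?thesis using sum_nu[of "\<lambda>_. 1::real"] card_S_pos by simp
qed

definition coef :: "'u \<Rightarrow> int \<Rightarrow> complex" where
  "coef u g = (\<Sum>s\<in>T u. chi g s) / card (T u)"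

definition nuhat :: "int \<Rightarrow> real" where
  "nuhat g = (\<Sum>u\<in>S. (norm (coef u g))\<^sup>2) / card S"

text \<open>Averaging over the fibre of the walk turns the transform of \<open>nu\<close>, a mean of the
  \<open>coef u\<close>, into a mean of squares; this is what makes it nonnegative.\<close>

lemma sum_nu_chi: "(\<Sum>s\<in>Z. of_real (nu s) * chi g s) = of_real (nuhat g)"
proof -
  have "(\<Sum>u\<in>S. coef u g) = (\<Sum>u\<in>S. (\<Sum>t\<in>T u. coef (act t u) g) / of_nat (card (T u)))"
    by (rule reversal[symmetric])
  also have "\<dots> = (\<Sum>u\<in>S. of_real ((norm (coef u g))\<^sup>2))"
  proof (rule sum.cong)
    fix u assume u: "u \<in> S"
    then have uU: "u \<in> U" using S_subset by auto
    have "coef (act t u) g = coef u g * cnj (chi g t)" for t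
    proof -
      have "(\<Sum>s\<in>T (act t u). chi g s) = (\<Sum>s\<in>T (act t u). chi g (s + t)) * chi g (- t)"
        by (simp add: sum_distrib_right flip: chi_add)
      then show ?thesis
        using sum_T_act[OF uU, of "chi g" t] by (simp add: coef_def card_T_act uU chi_minus)
    qed
    then have "(\<Sum>t\<in>T u. coef (act t u) g) / of_nat (card (T u)) = coef u g * cnj (coef u g)"
      by (simp add: coef_def sum_distrib_left)
    then show "(\<Sum>t\<in>T u. coef (act t u) g) / of_nat (card (T u)) = of_real ((norm (coef u g))\<^sup>2)"
      by (simp only: complex_norm_square)
  qed simp
  finally show ?thesis
    unfolding sum_nu nuhat_def by (simp flip: coef_def)
qed

lemma nuhat_nonneg: "0 \<le> nuhat g"
  by (simp add: nuhat_def sum_nonneg)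

lemma nuhat_le_1: "nuhat g \<le> 1"
proof -
  have "norm (coef u g) \<le> 1" if "u \<in> S" for u
  proof -
    have "norm (\<Sum>s\<in>T u. chi g s) \<le> (\<Sum>s\<in>T u. 1)"
      by (rule order_trans[OF norm_sum]) simp
    then show ?thesis using card_T_pos[OF that] by (simp add: coef_def norm_divide)
  qed
  then have "(\<Sum>u\<in>S. (norm (coef u g))\<^sup>2) \<le> (\<Sum>u\<in>S. 1)"
    by (intro sum_mono) (simp add: power_le_one)
  then show ?thesis using card_S_pos by (simp add: nuhat_def)
qed

text \<open>Chang's inequality is applied to each \<open>T u\<close> and averaged over
  \<open>u\<close>. Concavity of \<open>ln\<close> moves the average inside, where
  \<open>sum_inverse_card_T\<close> bounds it.\<close>

lemma sum_nuhat_dissociated: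
  assumes "finite L" "dissociated L"
  shows "(\<Sum>g\<in>L. nuhat g) \<le> 2 * ln (card U / card S)"
proof -
  define r where "r u = of_int M / card (T u)" for u
  have r: "0 < r u" if "u \<in> S" for u using M_pos card_T_pos[OF that] by (simp add: r_def)
  have "exp ((\<Sum>u\<in>S. ln (r u)) / card S) \<le> (\<Sum>u\<in>S. exp (ln (r u))) / card S"
    by (rule exp_average_le[OF finite_S S_nonempty])
  also have "\<dots> = (\<Sum>u\<in>S. r u) / card S" using r by simp
  also have "\<dots> \<le> card U / card S"
    unfolding r_def by (intro divide_right_mono sum_inverse_card_T) simp
  finally have le: "(\<Sum>u\<in>S. ln (r u)) / card S \<le> ln (card U / card S)"
    by (meson exp_gt_zero less_le_trans ln_ge_iff)
  have "(\<Sum>g\<in>L. nuhat g) = (\<Sum>u\<in>S. \<Sum>g\<in>L. (norm (coef u g))\<^sup>2) / card S"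
    unfolding nuhat_def by (subst sum.swap) (simp add: sum_divide_distrib)
  also have "\<dots> \<le> (\<Sum>u\<in>S. 2 * ln (r u)) / card S"
    unfolding coef_def r_def using zero_in_T T_subset
    by (intro divide_right_mono sum_mono Chang assms) auto
  also have "\<dots> \<le> 2 * ln (card U / card S)"
    using le by (simp flip: sum_distrib_left)
  finally show ?thesis .
qed

section \<open>The averaging operator and exponential moments along the walk\<close>

definition P :: "(int \<Rightarrow> real) \<Rightarrow> int \<Rightarrow> real" where
  "P g x = (\<Sum>s\<in>Z. nu s * g (x + s))"

lemma P_mod:
  assumes "\<And>x. g (x mod M) = g x"
  shows "P g (x mod M) = P g x"
proof -
  have "g (x mod M + s) = g (x + s)" for s
    using assms[of "x + s"] assms[of "x mod M + s"] by (simp add: mod_simps)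
  then show ?thesis by (simp add: P_def)
qed

lemma funpow_P_mod:
  assumes "\<And>x. g (x mod M) = g x"
  shows "(P ^^ n) g (x mod M) = (P ^^ n) g x"
  by (induction n arbitrary: x) (auto intro: assms P_mod)

lemma P_nonneg: "(\<And>x. 0 \<le> g x) \<Longrightarrow> 0 \<le> P g x"
  by (auto simp: P_def intro!: sum_nonneg mult_nonneg_nonneg nu_nonneg)

lemma funpow_P_nonneg: "(\<And>x. 0 \<le> g x) \<Longrightarrow> 0 \<le> (P ^^ n) g x"
  by (induction n arbitrary: x) (auto intro: P_nonneg)

lemma sum_P:
  assumes "\<And>x. g (x mod M) = g x"
  shows "(\<Sum>x\<in>Z. P g x) = (\<Sum>x\<in>Z. g x)"
proof -
  have "(\<Sum>x\<in>Z. P g x) = (\<Sum>s\<in>Z. nu s * (\<Sum>x\<in>Z. g (x + s)))"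
    unfolding P_def by (subst sum.swap) (simp add: sum_distrib_left)
  also have "\<dots> = (\<Sum>x\<in>Z. g x)"
    using nu_sum by (simp add: sum_shift[of g, OF assms] flip: sum_distrib_right)
  finally show ?thesis .
qed

lemma sum_funpow_P:
  assumes "\<And>x. g (x mod M) = g x"
  shows "(\<Sum>x\<in>Z. (P ^^ n) g x) = (\<Sum>x\<in>Z. g x)"
  by (induction n) (simp_all add: sum_P funpow_P_mod[of g, OF assms])

lemma P_diff: "P (\<lambda>x. g x - h x) x = P g x - P h x"
  by (simp add: P_def sum_subtractf right_diff_distrib)

lemma P_cmult: "P (\<lambda>x. a * g x) x = a * P g x"
  by (simp add: P_def sum_distrib_left mult.left_commute)

lemma P_sum: "P (\<lambda>x. \<Sum>j\<in>J. g j x) x = (\<Sum>j\<in>J. P (g j) x)"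
  unfolding P_def by (subst sum.swap) (simp add: sum_distrib_left)

text \<open>Each character is an eigenfunction of \<open>P\<close> with eigenvalue
  \<open>nuhat g\<close>, by \<open>sum_nu_chi\<close>.\<close>

lemma funpow_P_Fourier:
  assumes "\<And>x. complex_of_real (f x) = (\<Sum>g\<in>Z. b g * chi g x)"
  shows "complex_of_real ((P ^^ n) f x) = (\<Sum>g\<in>Z. b g * of_real (nuhat g) ^ n * chi g x)"
proof (induction n arbitrary: x)
  case (Suc n)
  have "complex_of_real ((P ^^ Suc n) f x)
      = (\<Sum>s\<in>Z. of_real (nu s) * (\<Sum>g\<in>Z. b g * of_real (nuhat g) ^ n * chi g (x + s)))"
    by (simp add: P_def Suc)
  also have "\<dots> = (\<Sum>g\<in>Z. b g * of_real (nuhat g) ^ n * chi g x * (\<Sum>s\<in>Z. of_real (nu s) * chi g s))"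
    unfolding sum_distrib_left by (subst sum.swap) (simp add: chi_add algebra_simps)
  finally show ?case unfolding sum_nu_chi by (simp add: ac_simps)
qed (simp add: assms)

text \<open>Reversibility of the walk: the value \<open>F u x\<close> seen before the step equals
  \<open>F (act s u) (x + s)\<close> seen after it, and \<open>act s u\<close> is again uniformly distributed.\<close>

lemma sum_exp_step:
  fixes F :: "'u \<Rightarrow> int \<Rightarrow> real" and f G :: "int \<Rightarrow> real" and l c :: real
  assumes F_shift: "\<And>u s x. u \<in> U \<Longrightarrow> F (act s u) (x + s) = F u x"
    and F_mod: "\<And>u x. F u (x mod M) = F u x"
    and f: "\<And>x. f x = (\<Sum>u\<in>S. F u x) / card S"
    and mgf: "\<And>x. (\<Sum>u\<in>S. exp (- l * F u x)) / card S \<le> exp (- l * f x + c * f x)"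
    and G_mod: "\<And>x. G (x mod M) = G x"
  shows "(\<Sum>x\<in>Z. exp (l * (P f x - f x) - c * P f x + P G x)) \<le> (\<Sum>x\<in>Z. exp (G x))"
proof -
  have f_mod: "f (x mod M) = f x" for x by (simp add: f F_mod)
  define W where "W u = 1 / (real (card S) * card (T u))" for u
  \<comment> \<open>The terms added to \<open>G\<close> are those that the exponential moment bound
    for \<open>F\<close> cancels at the end.\<close>
  define q where "q y = l * f y - c * f y + G y" for y
  have q_mod: "q (y mod M) = q y" for y by (simp add: q_def f_mod G_mod)
  define R where "R = Sigma S T"
  have finR: "finite R" and R_ne: "R \<noteq> {}"
    using finite_S S_nonempty zero_in_T by (auto simp: R_def)
  have sum_R: "(\<Sum>(u, s)\<in>R. W u * h u s) = (\<Sum>u\<in>S. (\<Sum>s\<in>T u. h u s) / card (T u)) / card S"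
    for h :: "'u \<Rightarrow> int \<Rightarrow> real"
    unfolding R_def W_def
    by (subst sum.Sigma[symmetric]) (auto simp: finite_S sum_divide_distrib intro!: sum.cong)
  have W1: "(\<Sum>p\<in>R. W (fst p)) = 1"
    using sum_R[of "\<lambda>_ _. 1"] sum_nu[of "\<lambda>_. 1::real"] nu_sum by (simp add: case_prod_beta)
  \<comment> \<open>The exponent on the left is the mean of \<open>q (x + s) - l * F u x\<close>
    under the joint law \<open>W\<close> of \<open>(u, s)\<close>, so Jensen's inequality
    applies.\<close>
  have step: "exp (l * (P f x - f x) - c * P f x + P G x)
      \<le> (\<Sum>p\<in>R. W (fst p) * exp (q (x + snd p) - l * F (fst p) x))" for x
  proof -
    have "(\<Sum>(u, s)\<in>R. W u * (q (x + s) - l * F u x))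
        = (\<Sum>(u, s)\<in>R. W u * q (x + s)) - l * (\<Sum>(u, s)\<in>R. W u * F u x)"
      by (simp add: case_prod_beta right_diff_distrib sum_subtractf sum_distrib_left mult.left_commute)
    also have "(\<Sum>(u, s)\<in>R. W u * F u x) = f x"
    proof -
      have "(\<Sum>u\<in>S. (\<Sum>s\<in>T u. F u x) / card (T u)) = (\<Sum>u\<in>S. F u x)"
        using zero_in_T by (intro sum.cong) auto
      then show ?thesis by (simp only: sum_R f)
    qed
    also have "(\<Sum>(u, s)\<in>R. W u * q (x + s)) = P q x"
      using sum_nu[of "\<lambda>s. q (x + s)"] by (simp add: sum_R P_def)
    also have "P q x = l * P f x - c * P f x + P G x"
      by (simp add: P_def q_def algebra_simps sum.distrib sum_subtractf sum_distrib_left)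
    finally have "l * (P f x - f x) - c * P f x + P G x
        = (\<Sum>p\<in>R. W (fst p) *\<^sub>R (q (x + snd p) - l * F (fst p) x))"
      by (simp add: case_prod_beta algebra_simps)
    then show ?thesis
      using convex_on_sum[OF finR R_ne exp_convex W1, of "\<lambda>p. q (x + snd p) - l * F (fst p) x"]
      by (simp add: W_def)
  qed
  define H where "H v = (\<Sum>x\<in>Z. exp (q x - l * F v x))" for v
  have "(\<Sum>x\<in>Z. exp (l * (P f x - f x) - c * P f x + P G x))
      \<le> (\<Sum>x\<in>Z. \<Sum>p\<in>R. W (fst p) * exp (q (x + snd p) - l * F (fst p) x))"
    by (intro sum_mono step)
  also have "\<dots> = (\<Sum>p\<in>R. W (fst p) * (\<Sum>x\<in>Z. exp (q (x + snd p) - l * F (fst p) x)))"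
    by (subst sum.swap) (simp add: sum_distrib_left)
  \<comment> \<open>After summing over all \<open>x\<close>, the inner sum depends on
    \<open>(u, s)\<close> only through the endpoint \<open>act s u\<close>, which is what
    \<open>reversal\<close> needs.\<close>
  also have "\<dots> = (\<Sum>p\<in>R. W (fst p) * H (act (snd p) (fst p)))"
  proof (intro sum.cong refl arg_cong[of _ _ "(*) _"])
    fix p assume "p \<in> R"
    then have u: "fst p \<in> U" using S_subset by (auto simp: R_def)
    have "(\<Sum>x\<in>Z. exp (q (x + snd p) - l * F (fst p) x))
        = (\<Sum>x\<in>Z. exp (q (x + snd p) - l * F (act (snd p) (fst p)) (x + snd p)))"
      by (simp add: F_shift u)
    also have "\<dots> = H (act (snd p) (fst p))"
      unfolding H_def by (rule sum_shift) (simp add: q_mod F_mod)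
    finally show "(\<Sum>x\<in>Z. exp (q (x + snd p) - l * F (fst p) x)) = H (act (snd p) (fst p))" .
  qed
  also have "\<dots> = (\<Sum>u\<in>S. H u) / card S"
    using sum_R[of "\<lambda>u s. H (act s u)"] reversal[of H] by (simp add: case_prod_beta)
  also have "\<dots> = (\<Sum>x\<in>Z. exp (q x) * ((\<Sum>u\<in>S. exp (- l * F u x)) / card S))"
    unfolding H_def
    by (subst sum.swap) (simp add: sum_divide_distrib sum_distrib_left flip: exp_add)
  also have "\<dots> \<le> (\<Sum>x\<in>Z. exp (q x) * exp (- l * f x + c * f x))"
    by (intro sum_mono mult_left_mono mgf) simp
  also have "\<dots> = (\<Sum>x\<in>Z. exp (G x))"
    by (simp add: q_def flip: exp_add)
  finally show ?thesis .
qed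

text \<open>Induction on \<open>n\<close>: \<open>sum_exp_step\<close> is used with \<open>G\<close>
  the exponent for \<open>n\<close> steps. Applying \<open>P\<close> raises every index by one, and
  the new step supplies the term with \<open>j = 1\<close>.\<close>

lemma sum_exp_walk:
  fixes F :: "'u \<Rightarrow> int \<Rightarrow> real" and f :: "int \<Rightarrow> real" and l c :: real
  assumes F_shift: "\<And>u s x. u \<in> U \<Longrightarrow> F (act s u) (x + s) = F u x"
    and F_mod: "\<And>u x. F u (x mod M) = F u x"
    and f: "\<And>x. f x = (\<Sum>u\<in>S. F u x) / card S"
    and mgf: "\<And>x. (\<Sum>u\<in>S. exp (- l * F u x)) / card S \<le> exp (- l * f x + c * f x)"
  shows "(\<Sum>x\<in>Z. exp (l * ((P ^^ n) f x - f x) - c * (\<Sum>j=1..n. (P ^^ j) f x))) \<le> of_int M"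
proof (induction n)
  case 0
  then show ?case using M_pos by simp
next
  case (Suc n)
  have f_mod: "f (x mod M) = f x" for x by (simp add: f F_mod)
  define G where "G x = l * ((P ^^ n) f x - f x) - c * (\<Sum>j=1..n. (P ^^ j) f x)" for x
  have G_mod: "G (x mod M) = G x" for x
    by (simp add: G_def f_mod funpow_P_mod[of f, OF f_mod])
  have "P G x = l * (P ((P ^^ n) f) x - P f x) - c * (\<Sum>j=1..n. P ((P ^^ j) f) x)" for x
    unfolding G_def by (simp add: P_diff P_cmult P_sum)
  moreover have "(\<Sum>j=1..Suc n. (P ^^ j) f x) = P f x + (\<Sum>j=1..n. P ((P ^^ j) f) x)" for x
  proof -
    have "(\<Sum>j=1..Suc n. (P ^^ j) f x) = P f x + (\<Sum>j=Suc 1..Suc n. (P ^^ j) f x)"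
      by (subst sum.atLeast_Suc_atMost) simp_all
    also have "(\<Sum>j=Suc 1..Suc n. (P ^^ j) f x) = (\<Sum>j=1..n. P ((P ^^ j) f) x)"
      by (subst sum.shift_bounds_cl_Suc_ivl) simp
    finally show ?thesis .
  qed
  ultimately have "l * ((P ^^ Suc n) f x - f x) - c * (\<Sum>j=1..Suc n. (P ^^ j) f x)
      = l * (P f x - f x) - c * P f x + P G x" for x
    by (simp add: algebra_simps)
  then have "(\<Sum>x\<in>Z. exp (l * ((P ^^ Suc n) f x - f x) - c * (\<Sum>j=1..Suc n. (P ^^ j) f x)))
      \<le> (\<Sum>x\<in>Z. exp (G x))"
    using sum_exp_step[of F f l c G, OF F_shift F_mod f mgf G_mod] by simp
  with Suc show ?case by (simp add: G_def)
qed

text \<open>At a zero of \<open>f\<close> the exponent in \<open>sum_exp_walk\<close> has no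
  negative term \<open>- l * f x\<close>. The starting points \<open>x + t x\<close> have density at
  most \<open>card D\<close> relative to the uniform distribution, so Jensen bounds the mean
  exponent there by \<open>ln (card D)\<close>. It remains to choose \<open>l\<close> and absorb the
  sum over \<open>j\<close>.\<close>

lemma walk_from_zeros:
  fixes F :: "'u \<Rightarrow> int \<Rightarrow> real" and f :: "int \<Rightarrow> real" and k m :: nat
  assumes F_shift: "\<And>u s x. u \<in> U \<Longrightarrow> F (act s u) (x + s) = F u x"
    and F_mod: "\<And>u x. F u (x mod M) = F u x"
    and f: "\<And>x. f x = (\<Sum>u\<in>S. F u x) / card S"
    and f_nonneg: "\<And>x. 0 \<le> f x"
    and k: "0 < k" and m: "0 < m"
    and mgf: "\<And>l x. 0 \<le> l \<Longrightarrow>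
      (\<Sum>u\<in>S. exp (- l * F u x)) / card S \<le> exp (- l * f x + l\<^sup>2 / (2 * k) * f x)"
    and D: "finite D" and t: "\<And>x. x \<in> Z \<Longrightarrow> t x \<in> D \<and> f (x + t x) = 0"
  shows "(\<Sum>x\<in>Z. (P ^^ m) f (x + t x)) / of_int M \<le> 2 * m * ln (card D) / k"
proof -
  have f_mod: "f (x mod M) = f x" for x by (simp add: f F_mod)
  \<comment> \<open>With this \<open>l\<close> the total error coefficient \<open>c * m\<close> is
    exactly \<open>l / 2\<close>.\<close>
  define l where "l = real k / m"
  define c where "c = l\<^sup>2 / (2 * k)"
  define phi where "phi n = (\<Sum>x\<in>Z. (P ^^ n) f (x + t x)) / of_int M" for n
  have l_pos: "0 < l" using k m by (simp add: l_def)
  have cm: "c * m = l / 2" using k m by (simp add: c_def l_def field_simps power2_eq_square)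
  have c_pos: "0 < c" using l_pos k by (simp add: c_def)
  have phi_nonneg: "0 \<le> phi n" for n
    using M_pos by (auto simp: phi_def intro!: divide_nonneg_nonneg sum_nonneg funpow_P_nonneg f_nonneg)
  have ne: "Z \<noteq> {}" "D \<noteq> {}" using M_pos t by auto
  then have D_pos: "0 < card D" using D by (simp add: card_gt_0_iff)
  have cZ: "real (card Z) = of_int M" using M_pos by simp
  have main: "l * phi n - c * (\<Sum>j=1..n. phi j) \<le> ln (card D)" for n
  proof -
    define G where "G x = l * ((P ^^ n) f x - f x) - c * (\<Sum>j=1..n. (P ^^ j) f x)" for x
    have G_mod: "G (x mod M) = G x" for x
      by (simp add: G_def f_mod funpow_P_mod[of f, OF f_mod])
    have "(\<Sum>x\<in>Z. G (x + t x)) = (\<Sum>x\<in>Z. l * (P ^^ n) f (x + t x) - c * (\<Sum>j=1..n. (P ^^ j) f (x + t x)))"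
      using t by (intro sum.cong) (auto simp: G_def)
    also have "\<dots> = l * (\<Sum>x\<in>Z. (P ^^ n) f (x + t x)) - c * (\<Sum>j=1..n. \<Sum>x\<in>Z. (P ^^ j) f (x + t x))"
      by (subst sum.swap) (simp add: sum_subtractf sum_distrib_left)
    finally have eq: "(\<Sum>x\<in>Z. G (x + t x)) / card Z = l * phi n - c * (\<Sum>j=1..n. phi j)"
      unfolding cZ phi_def by (simp add: diff_divide_distrib flip: sum_divide_distrib)
    have "exp ((\<Sum>x\<in>Z. G (x + t x)) / card Z) \<le> (\<Sum>x\<in>Z. exp (G (x + t x))) / card Z"
      using ne by (intro exp_average_le) auto
    \<comment> \<open>Replacing the chosen shift \<open>t x\<close> by all shifts in
      \<open>D\<close> makes the sum translation invariant, at the cost of the factor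
      \<open>card D\<close>.\<close>
    also have "(\<Sum>x\<in>Z. exp (G (x + t x))) \<le> (\<Sum>x\<in>Z. \<Sum>d\<in>D. exp (G (x + d)))"
    proof (rule sum_mono)
      fix x assume "x \<in> Z"
      then show "exp (G (x + t x)) \<le> (\<Sum>d\<in>D. exp (G (x + d)))"
        using t D by (intro member_le_sum[of _ D "\<lambda>d. exp (G (x + d))"]) auto
    qed
    also have "\<dots> = (\<Sum>d\<in>D. \<Sum>x\<in>Z. exp (G x))"
    proof (subst sum.swap, rule sum.cong)
      show "(\<Sum>x\<in>Z. exp (G (x + d))) = (\<Sum>x\<in>Z. exp (G x))" for d
        by (rule sum_shift) (simp add: G_mod)
    qed simp
    also have "\<dots> \<le> (\<Sum>d\<in>D. of_int M)"
      unfolding G_def using mgf[of l] l_pos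
      by (intro sum_mono sum_exp_walk[of F] F_shift F_mod f) (auto simp: c_def)
    finally have "exp (l * phi n - c * (\<Sum>j=1..n. phi j)) \<le> card D"
      unfolding eq using M_pos by (simp add: divide_right_mono)
    then show ?thesis using D_pos by (simp add: ln_ge_iff)
  qed
  \<comment> \<open>Taking \<open>n\<close> where \<open>phi\<close> is largest bounds the sum of
    the earlier means by \<open>m * phi n\<close>, so it uses up at most half of
    \<open>l * phi n\<close>.\<close>
  have "Max (phi ` {..m}) \<in> phi ` {..m}" by (rule Max_in) auto
  then obtain n where "n \<le> m" "Max (phi ` {..m}) = phi n" by blast
  then obtain n where n: "n \<le> m" and max: "\<And>j. j \<le> m \<Longrightarrow> phi j \<le> phi n"
    by (metis Max_ge atMost_iff finite_atMost finite_imageI imageI)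
  have "(\<Sum>j=1..n. phi j) \<le> (\<Sum>j=1..n. phi n)" using n by (intro sum_mono max) auto
  also have "\<dots> \<le> m * phi n" using n phi_nonneg by (simp add: mult_right_mono)
  finally have "c * (\<Sum>j=1..n. phi j) \<le> (c * m) * phi n"
    using c_pos by (simp add: mult.assoc)
  then have "l * phi n - l / 2 * phi n \<le> ln (card D)" using main[of n] by (simp add: cm)
  then have "l * phi n \<le> 2 * ln (card D)" by simp
  then have "phi n \<le> 2 * ln (card D) / l" using l_pos by (simp add: field_simps)
  also have "\<dots> = 2 * m * ln (card D) / k" using k m by (simp add: l_def)
  finally show ?thesis using max[of m] by (simp add: phi_def)
qed

end

section \<open>Progressions in sumsets of residues\<close>

context cyclic_modulus
begin

section \<open>Popularity of sums and its Fourier expansion\<close>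

definition residue_ind :: "int set \<Rightarrow> int \<Rightarrow> real" where
  "residue_ind B z = (if z mod M \<in> B then 1 else 0)"

lemma residue_ind_nonneg [simp]: "0 \<le> residue_ind B z"
  by (simp add: residue_ind_def)

lemma residue_ind_mod: "residue_ind B (z mod M - y) = residue_ind B (z - y)"
  by (simp add: residue_ind_def mod_simps)

lemma sum_residue_ind:
  assumes "B \<subseteq> Z"
  shows "(\<Sum>x\<in>Z. residue_ind B (x - y)) = card B"
proof -
  have "(\<Sum>x\<in>Z. residue_ind B (x - y)) = (\<Sum>x\<in>Z. residue_ind B x)"
    using sum_shift[of "residue_ind B" "- y"] by (simp add: residue_ind_def)
  also have "\<dots> = (\<Sum>x\<in>Z. if x \<in> B then 1 else 0)"
    by (intro sum.cong) (auto simp: residue_ind_def)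
  also have "\<dots> = card B"
    using assms by (simp add: sum.If_cases Int_absorb1)
  finally show ?thesis .
qed

lemma dvd_diff_iff_eq: "x \<in> Z \<Longrightarrow> y \<in> Z \<Longrightarrow> M dvd (x - y) \<longleftrightarrow> x = y"
  by (auto simp: mod_eq_dvd_iff[symmetric])

definition fourier :: "int set \<Rightarrow> int \<Rightarrow> complex" where
  "fourier B g = (\<Sum>y\<in>B. chi g (- y))"

lemma Parseval:
  assumes "B \<subseteq> Z"
  shows "(\<Sum>g\<in>Z. (norm (fourier B g))\<^sup>2) = of_int M * real (card B)"
proof -
  have fin: "finite B" using assms finite_subset by auto
  have "complex_of_real (\<Sum>g\<in>Z. (norm (fourier B g))\<^sup>2) = (\<Sum>g\<in>Z. \<Sum>y\<in>B. \<Sum>z\<in>B. chi (z - y) g)"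
  proof -
    have "complex_of_real ((norm (fourier B g))\<^sup>2) = (\<Sum>y\<in>B. \<Sum>z\<in>B. chi (z - y) g)" for g
    proof -
      have "complex_of_real ((norm (fourier B g))\<^sup>2) = fourier B g * cnj (fourier B g)"
        by (simp only: complex_norm_square)
      also have "\<dots> = (\<Sum>y\<in>B. \<Sum>z\<in>B. chi g (- y) * cnj (chi g (- z)))"
        by (simp add: fourier_def sum_product)
      also have "\<dots> = (\<Sum>y\<in>B. \<Sum>z\<in>B. chi (z - y) g)"
      proof (intro sum.cong refl)
        fix y z
        show "chi g (- y) * cnj (chi g (- z)) = chi (z - y) g"
          using chi_add[of g z "- y"] by (simp add: chi_minus chi_commute[of "z - y" g])
      qed
      finally show ?thesis .
    qed
    then show ?thesis by simp
  qed
  also have "\<dots> = (\<Sum>y\<in>B. \<Sum>z\<in>B. \<Sum>g\<in>Z. chi (z - y) g)"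
    by (rule trans[OF sum.swap]) (intro sum.cong refl sum.swap)
  also have "\<dots> = (\<Sum>y\<in>B. \<Sum>z\<in>B. if z = y then of_int M else 0)"
    using assms by (intro sum.cong refl) (auto simp: sum_chi dvd_diff_iff_eq subset_iff)
  also have "\<dots> = of_int M * real (card B)"
    using fin by simp
  finally have "complex_of_real (\<Sum>g\<in>Z. (norm (fourier B g))\<^sup>2) = complex_of_real (of_int M * real (card B))"
    by simp
  then show ?thesis by (simp only: of_real_eq_iff)
qed

lemma residue_ind_Fourier:
  assumes "B \<subseteq> Z"
  shows "complex_of_real (residue_ind B z) = (\<Sum>g\<in>Z. fourier B g / of_int M * chi g z)"
proof -
  have fin: "finite B" using assms finite_subset by auto
  have "(\<Sum>g\<in>Z. fourier B g * chi g z) = (\<Sum>g\<in>Z. \<Sum>y\<in>B. chi (z mod M - y) g)"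
  proof (intro sum.cong refl)
    fix g
    have "chi g (- y) * chi g z = chi (z mod M - y) g" for y
    proof -
      have "chi g (- y) * chi g z = chi g (- y) * chi g (z mod M)" by (simp only: chi_mod)
      also have "\<dots> = chi g (z mod M - y)" using chi_add[of g "- y" "z mod M"] by (simp del: chi_mod)
      finally show ?thesis by (simp only: chi_commute[of g])
    qed
    then show "fourier B g * chi g z = (\<Sum>y\<in>B. chi (z mod M - y) g)"
      by (simp add: fourier_def sum_distrib_right)
  qed
  also have "\<dots> = (\<Sum>y\<in>B. \<Sum>g\<in>Z. chi (z mod M - y) g)"
    by (rule sum.swap)
  also have "\<dots> = (\<Sum>y\<in>B. if z mod M = y then of_int M else 0)"
    using assms M_pos by (intro sum.cong refl) (auto simp: sum_chi dvd_diff_iff_eq subset_iff)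
  also have "\<dots> = of_int M * complex_of_real (residue_ind B z)"
    using fin by (simp add: residue_ind_def)
  finally show ?thesis
    using M_pos by (simp add: mult.commute flip: sum_divide_distrib)
qed

text \<open>The function \<open>f\<close> of the introduction: the convolution of the indicators of
  \<open>A\<close> and \<open>B\<close>, normalised by \<open>card A\<close>.\<close>

definition popularity :: "int set \<Rightarrow> int set \<Rightarrow> int \<Rightarrow> real" where
  "popularity A B x = (\<Sum>y\<in>A. residue_ind B (x - y)) / card A"

lemma popularity_nonneg: "0 \<le> popularity A B x"
  by (simp add: popularity_def sum_nonneg)

lemma popularity_nonzero:
  assumes "popularity A B x \<noteq> 0"
  shows "\<exists>y\<in>A. \<exists>z\<in>B. x mod M = (y + z) mod M"
proof -
  have "\<exists>y\<in>A. residue_ind B (x - y) \<noteq> 0"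
  proof (rule ccontr)
    assume "\<not> ?thesis"
    then have "(\<Sum>y\<in>A. residue_ind B (x - y)) = 0" by (intro sum.neutral) auto
    then show False using assms by (simp add: popularity_def)
  qed
  then obtain y where y: "y \<in> A" "(x - y) mod M \<in> B"
    by (auto simp: residue_ind_def split: if_splits)
  moreover have "x mod M = (y + (x - y) mod M) mod M" by (simp add: mod_simps)
  ultimately show ?thesis by blast
qed

definition popularity_coef :: "int set \<Rightarrow> int set \<Rightarrow> int \<Rightarrow> complex" where
  "popularity_coef A B g = fourier B g / of_int M * (fourier A g / of_nat (card A))"

lemma popularity_Fourier:
  assumes "B \<subseteq> Z"
  shows "complex_of_real (popularity A B x) = (\<Sum>g\<in>Z. popularity_coef A B g * chi g x)"
proof -
  have "complex_of_real (popularity A B x)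
      = (\<Sum>y\<in>A. \<Sum>g\<in>Z. fourier B g / of_int M * chi g (x + - y)) / of_nat (card A)"
    by (simp add: popularity_def residue_ind_Fourier[OF assms])
  also have "\<dots> = (\<Sum>g\<in>Z. \<Sum>y\<in>A. fourier B g / of_int M * chi g (x + - y)) / of_nat (card A)"
    by (subst sum.swap) simp
  also have "\<dots> = (\<Sum>g\<in>Z. popularity_coef A B g * chi g x)"
    unfolding popularity_coef_def fourier_def chi_add sum_divide_distrib
    by (intro sum.cong refl) (simp add: sum_distrib_left sum_distrib_right sum_divide_distrib algebra_simps)
  finally show ?thesis .
qed

text \<open>Cauchy-Schwarz and Parseval: a convolution has an absolutely summable transform, with a
  bound that does not involve \<open>M\<close>.\<close>

lemma sum_norm_popularity_coef:
  assumes A: "A \<subseteq> Z" "A \<noteq> {}" and B: "B \<subseteq> Z"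
  shows "(\<Sum>g\<in>Z. norm (popularity_coef A B g)) \<le> sqrt (card B / card A)"
proof -
  have "finite A" using A finite_subset by auto
  then have a: "0 < card A" using A by (simp add: card_gt_0_iff)
  have "(\<Sum>g\<in>Z. norm (popularity_coef A B g))
      = (\<Sum>g\<in>Z. norm (fourier B g) * norm (fourier A g)) / (of_int M * real (card A))"
    using M_pos by (simp add: popularity_coef_def norm_mult norm_divide sum_divide_distrib)
  also have "\<dots> \<le> sqrt ((of_int M * real (card B)) * (of_int M * real (card A))) / (of_int M * real (card A))"
  proof (rule divide_right_mono)
    have "(\<Sum>g\<in>Z. norm (fourier B g) * norm (fourier A g))\<^sup>2
        \<le> (\<Sum>g\<in>Z. (norm (fourier B g))\<^sup>2) * (\<Sum>g\<in>Z. (norm (fourier A g))\<^sup>2)"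
      by (rule Cauchy_Schwarz_ineq_sum)
    then show "(\<Sum>g\<in>Z. norm (fourier B g) * norm (fourier A g))
        \<le> sqrt ((of_int M * real (card B)) * (of_int M * real (card A)))"
      unfolding Parseval[OF A(1)] Parseval[OF B] by (rule real_le_rsqrt)
  qed (use M_pos in simp)
  also have "\<dots> = sqrt (card B / card A)"
  proof -
    have "sqrt ((of_int M * real (card B)) * (of_int M * real (card A))) / (of_int M * real (card A))
        = sqrt ((of_int M * real (card B)) * (of_int M * real (card A)) / (of_int M * real (card A))\<^sup>2)"
      using M_pos by (simp add: real_sqrt_divide)
    also have "(of_int M * real (card B)) * (of_int M * real (card A)) / (of_int M * real (card A))\<^sup>2 = real (card B) / card A"
      using M_pos a by (simp add: power2_eq_square)
    finally show ?thesis .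
  qed
  finally show ?thesis .
qed

lemma sum_popularity:
  assumes A: "A \<subseteq> Z" "A \<noteq> {}" and B: "B \<subseteq> Z"
  shows "(\<Sum>x\<in>Z. popularity A B x) = card B"
proof -
  have "finite A" using A finite_subset by auto
  then have a: "0 < card A" using A by (simp add: card_gt_0_iff)
  have "(\<Sum>x\<in>Z. popularity A B x) = (\<Sum>y\<in>A. \<Sum>x\<in>Z. residue_ind B (x - y)) / card A"
    unfolding popularity_def sum_divide_distrib[symmetric] by (subst sum.swap) simp
  then show ?thesis using a by (simp add: sum_residue_ind[OF B])
qed

end

section \<open>Estimates for random tuples and for phases\<close>

text \<open>One coordinate of a uniform tuple is uniform: \<open>h (u i)\<close> is written as a
  product over all coordinates with factors 1 away from \<open>i\<close>, and the sum
  factorises.\<close>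

lemma sum_PiE_coordinate:
  fixes h :: "'a \<Rightarrow> real"
  assumes "finite I" "finite A" "A \<noteq> {}" "i \<in> I"
  shows "(\<Sum>u\<in>PiE I (\<lambda>_. A). h (u i)) / card (PiE I (\<lambda>_. A)) = (\<Sum>y\<in>A. h y) / card A"
proof -
  have a: "0 < card A" using assms by (simp add: card_gt_0_iff)
  have "(\<Sum>u\<in>PiE I (\<lambda>_. A). h (u i)) = (\<Sum>u\<in>PiE I (\<lambda>_. A). \<Prod>j\<in>I. if j = i then h (u j) else 1)"
    using assms by simp
  also have "\<dots> = (\<Prod>j\<in>I. \<Sum>y\<in>A. if j = i then h y else 1)"
    using assms by (subst prod_sum_PiE) auto
  also have "\<dots> = (\<Prod>j\<in>I. if j = i then (\<Sum>y\<in>A. h y) else card A)"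
    by (intro prod.cong) auto
  also have "\<dots> = (\<Sum>y\<in>A. h y) * card A ^ (card I - 1)"
  proof -
    have "(\<Prod>j\<in>I - {i}. if j = i then (\<Sum>y\<in>A. h y) else real (card A)) = (\<Prod>j\<in>I - {i}. real (card A))"
      by (rule prod.cong) auto
    then show ?thesis using assms by (simp add: prod.remove[of I i])
  qed
  finally show ?thesis
    using assms a by (cases "card I") (auto simp: card_PiE)
qed

lemma one_minus_exp_ge: "0 \<le> r \<Longrightarrow> r - r\<^sup>2 / 2 \<le> 1 - exp (- r)" for r :: real
proof -
  assume r: "0 \<le> r"
  have "exp (- r) \<le> 1 - r + r\<^sup>2 / 2"
  proof -
    define h where "h x = 1 - x + x\<^sup>2 / 2 - exp (- x)" for x :: real
    have "h 0 \<le> h r"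
    proof (rule DERIV_nonneg_imp_nondecreasing[OF r])
      fix x :: real
      have "(h has_real_derivative (-1 + x + exp (- x))) (at x)"
        unfolding h_def by (auto intro!: derivative_eq_intros)
      moreover have "0 \<le> -1 + x + exp (- x)" using exp_ge_add_one_self[of "- x"] by simp
      ultimately show "\<exists>y. (h has_real_derivative y) (at x) \<and> 0 \<le> y" by blast
    qed
    then show ?thesis by (simp add: h_def)
  qed
  then show ?thesis by simp
qed

lemma norm_cis_minus_1_le: "norm (cis t - 1) \<le> \<bar>t\<bar>"
proof -
  have "norm (cis t - 1) = 2 * \<bar>sin (t / 2)\<bar>"
    unfolding cis_conv_exp by (rule dist_exp_i_1)
  also have "\<dots> \<le> \<bar>t\<bar>" using abs_sin_x_le_abs_x[of "t / 2"] by simp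
  finally show ?thesis .
qed

section \<open>Almost periods of the large spectrum and long progressions\<close>

context cyclic_modulus
begin

text \<open>The integer \<open>p\<close> is free because it shifts the phase by whole turns; it will
  be the numerator from Dirichlet's theorem.\<close>

lemma norm_chi_minus_1_le:
  "norm (chi g x - 1) \<le> 2 * pi * \<bar>of_int x * (of_int g / of_int M) - of_int p\<bar>"
proof -
  let ?t = "of_int x * (of_int g / of_int M) - of_int p :: real"
  have "chi g x = cis (2 * pi * ?t + 2 * pi * of_int p)"
    by (simp add: chi_def algebra_simps)
  also have "\<dots> = cis (2 * pi * ?t)"
    by (simp only: cis_mult[symmetric] cis_multiple_2pi[OF Ints_of_int] mult_1_right)
  finally show ?thesis using norm_cis_minus_1_le[of "2 * pi * ?t"] by (simp add: abs_mult)
qed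

text \<open>A product of unit complex numbers is as close to 1 as the sum of the distances of its
  factors, and conjugation preserves the distance to 1.\<close>

lemma norm_chi_span_minus_1_le:
  assumes fin: "finite L" and e: "\<forall>h\<in>L. e h \<in> {-1, 0, 1}" and dvd: "M dvd (g - (\<Sum>h\<in>L. e h * h))"
  shows "norm (chi g x - 1) \<le> (\<Sum>h\<in>L. norm (chi h x - 1))"
proof -
  have "chi g x = chi (g - (\<Sum>h\<in>L. e h * h)) x * chi (\<Sum>h\<in>L. e h * h) x"
    by (simp flip: chi_add_left)
  also have "\<dots> = (\<Prod>h\<in>L. chi (e h * h) x)"
    by (simp add: chi_dvd[OF dvd] chi_sum_left[OF fin])
  finally have "norm (chi g x - 1) = norm ((\<Prod>h\<in>L. chi (e h * h) x) - (\<Prod>h\<in>L. 1))" by simp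
  also have "\<dots> \<le> (\<Sum>h\<in>L. norm (chi (e h * h) x - 1))"
    by (rule norm_prod_diff) auto
  also have "\<dots> \<le> (\<Sum>h\<in>L. norm (chi h x - 1))"
  proof (rule sum_mono)
    fix h assume "h \<in> L"
    then consider "e h = -1" | "e h = 0" | "e h = 1" using e by auto
    then show "norm (chi (e h * h) x - 1) \<le> norm (chi h x - 1)"
    proof cases
      case 1
      have "norm (cnj (chi h x - 1)) = norm (chi h x - 1)" by (rule complex_mod_cnj)
      then show ?thesis using 1 by (simp add: chi_minus_left)
    qed auto
  qed
  finally show ?thesis .
qed

lemma norm_chi_mult_minus_1_le: "norm (chi g (int j * d) - 1) \<le> j * norm (chi g d - 1)"
proof -
  have "chi g (int j * d) = chi g d ^ j"
    by (induction j) (auto simp: ring_distribs chi_add mult.commute)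
  then show ?thesis using norm_power_diff[of "chi g d" 1 j] by simp
qed

text \<open>Let \<open>beta\<close> be the mean of the popularity. \<open>smoothing\<close> limits
  the oscillation from frequencies with \<open>nuhat g \<le> 1 / 2\<close> to
  \<open>beta / 4\<close>, the second part of \<open>rank\<close> does the same for the others, and
  \<open>sampling\<close> makes the walk bound smaller than \<open>beta / 2\<close>. In
  \<open>rank\<close>, \<open>n\<close> ranges over the possible sizes of the spanning set; its
  first part keeps Dirichlet's \<open>d\<close> below \<open>M\<close>.\<close>

theorem progression_mod:
  fixes A B :: "int set" and k m q l :: nat
  assumes A: "A \<subseteq> Z" "A \<noteq> {}" and B: "B \<subseteq> Z"
    and k: "0 < k" and m: "0 < m" and q: "0 < q" and l: "0 < l"
    and smoothing: "8 * sqrt (card B / card A) * of_int M \<le> 2 ^ m * card B"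
    and sampling: "4 * m * ln l * of_int M < k * card B"
    and rank: "\<And>n::nat. n \<le> 4 * k * ln (of_int M / card A) \<Longrightarrow>
      int (q ^ n) < M \<and> 8 * pi * sqrt (card B / card A) * n * l * of_int M \<le> card B * real q"
  shows "\<exists>x d. 0 < d \<and> d < M \<and> (\<forall>j<l. \<exists>y\<in>A. \<exists>z\<in>B. (x + int j * d) mod M = (y + z) mod M)"
proof -
  define U where "U = PiE {..<k} (\<lambda>_. Z)"
  define S where "S = PiE {..<k} (\<lambda>_. A)"
  define act where "act s u = (\<lambda>i\<in>{..<k}. (u i + s) mod M)" for s :: int and u :: "nat \<Rightarrow> int"
  have finA: "finite A" using A finite_subset by auto
  have a: "0 < card A" using finA A by (simp add: card_gt_0_iff)
  interpret translation_action M act U S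
  proof
    show "finite U" by (auto simp: U_def intro: finite_PiE)
    show "S \<subseteq> U" using A unfolding S_def U_def by (intro PiE_mono) auto
    show "S \<noteq> {}" using A by (auto simp: S_def PiE_eq_empty_iff)
    fix u s t assume u: "u \<in> U"
    show "act s u \<in> U" using M_pos by (auto simp: act_def U_def)
    show "act s (act t u) = act (s + t) u" by (auto simp: act_def mod_simps ac_simps)
    show "act 0 u = u" using u by (auto simp: act_def U_def PiE_def extensional_def fun_eq_iff Pi_def)
    show "act (s mod M) u = act s u" by (auto simp: act_def mod_simps)
  qed
  define f where "f = popularity A B"
  define F where "F u x = (\<Sum>i<k. residue_ind B (x - u i)) / k" for u and x :: int
  have F_shift: "F (act s u) (x + s) = F u x" if "u \<in> U" for u s x
  proof -
    have "residue_ind B (x + s - (u i + s) mod M) = residue_ind B (x - u i)" for i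
      by (simp add: residue_ind_def mod_simps)
    then show ?thesis by (simp add: F_def act_def)
  qed
  have F_mod: "F u (x mod M) = F u x" for u x
    by (simp add: F_def residue_ind_mod)
  have f_mod: "f (x mod M) = f x" for x
    by (simp add: f_def popularity_def residue_ind_mod)
  have f_nonneg: "0 \<le> f x" for x by (simp add: f_def popularity_nonneg)
  have f_avg: "f x = (\<Sum>u\<in>S. F u x) / card S" for x
  proof -
    have "(\<Sum>u\<in>S. F u x) / card S = (\<Sum>i<k. (\<Sum>u\<in>S. residue_ind B (x - u i)) / card S) / k"
      unfolding F_def sum_divide_distrib[symmetric] by (subst sum.swap) simp
    also have "\<dots> = (\<Sum>i<k. f x) / k"
      unfolding S_def f_def popularity_def using finA A
      by (intro arg_cong[of _ _ "\<lambda>z. z / real k"] sum.cong refl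
          sum_PiE_coordinate[of "{..<k}" A _ "\<lambda>y. residue_ind B (x - y)"]) auto
    finally show ?thesis using k by simp
  qed
  have cardS: "real (card S) = real (card A) ^ k" and cardU: "real (card U) = of_int M ^ k"
    using M_pos by (simp_all add: S_def U_def card_PiE)
  \<comment> \<open>The coordinates are independent, so the moment is a \<open>k\<close>-th power.
    The error term keeps the factor \<open>f x\<close>, which is what lets it be summed along the
    walk.\<close>
  have mgf: "(\<Sum>u\<in>S. exp (- r * F u x)) / card S \<le> exp (- r * f x + r\<^sup>2 / (2 * k) * f x)"
    if r: "0 \<le> r" for r x
  proof -
    define v where "v = r / k"
    have v: "0 \<le> v" using r by (simp add: v_def)
    have "(\<Sum>u\<in>S. exp (- r * F u x)) = (\<Sum>u\<in>S. \<Prod>i<k. exp (- v * residue_ind B (x - u i)))"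
      by (simp add: F_def v_def exp_sum[symmetric] sum_distrib_left sum_negf sum_divide_distrib)
    also have "\<dots> = (\<Prod>i<k. \<Sum>y\<in>A. exp (- v * residue_ind B (x - y)))"
      unfolding S_def using finA by (subst prod_sum_PiE) auto
    also have "\<dots> = (\<Sum>y\<in>A. exp (- v * residue_ind B (x - y))) ^ k" by simp
    \<comment> \<open>The indicator takes only the values 0 and 1, so the exponential is affine in
      it.\<close>
    also have "(\<Sum>y\<in>A. exp (- v * residue_ind B (x - y))) = (\<Sum>y\<in>A. 1 - (1 - exp (- v)) * residue_ind B (x - y))"
      by (intro sum.cong) (auto simp: residue_ind_def)
    also have "\<dots> = card A * (1 - (1 - exp (- v)) * f x)"
      using a by (simp add: f_def popularity_def sum_subtractf right_diff_distrib flip: sum_distrib_left)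
    finally have "(\<Sum>u\<in>S. exp (- r * F u x)) / card S = (1 - (1 - exp (- v)) * f x) ^ k"
      using a by (simp add: cardS power_mult_distrib)
    also have "\<dots> \<le> exp (- ((1 - exp (- v)) * f x)) ^ k"
    proof (rule power_mono)
      show "1 - (1 - exp (- v)) * f x \<le> exp (- ((1 - exp (- v)) * f x))"
        using exp_ge_add_one_self[of "- ((1 - exp (- v)) * f x)"] by simp
      have "f x \<le> 1"
      proof -
        have "(\<Sum>y\<in>A. residue_ind B (x - y)) \<le> (\<Sum>y\<in>A. 1)"
          by (intro sum_mono) (simp add: residue_ind_def)
        then show ?thesis using a by (simp add: f_def popularity_def)
      qed
      moreover have "1 - exp (- v) \<le> 1" by simp
      moreover have "0 \<le> 1 - exp (- v)" using v by simp
      ultimately have "(1 - exp (- v)) * f x \<le> 1 * 1" using f_nonneg by (intro mult_mono) auto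
      then show "0 \<le> 1 - (1 - exp (- v)) * f x" by simp
    qed
    also have "\<dots> = exp (- (k * (1 - exp (- v)) * f x))"
      by (simp add: exp_of_nat_mult[symmetric] mult.assoc)
    also have "\<dots> \<le> exp (- (k * (v - v\<^sup>2 / 2) * f x))"
      using one_minus_exp_ge[OF v] f_nonneg k by (simp add: mult_right_mono mult_left_mono)
    also have "\<dots> = exp (- r * f x + r\<^sup>2 / (2 * k) * f x)"
      using k by (simp add: v_def field_simps power2_eq_square)
    finally show ?thesis .
  qed
  define X where "X = {g \<in> Z. 1 / 2 < nuhat g}"
  have finX: "finite X" unfolding X_def by (rule finite_subset[of _ Z]) auto
  obtain L where L: "L \<subseteq> X" "dissociated L"
    and span: "\<And>g. g \<in> X \<Longrightarrow> \<exists>e. (\<forall>h\<in>L. e h \<in> {-1, 0, 1}) \<and> M dvd (g - (\<Sum>h\<in>L. e h * h))"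
    by (rule dissociated_span[OF finX]) (rule that)
  have finL: "finite L" using L(1) finX by (rule finite_subset)
  define n where "n = card L"
  \<comment> \<open>Every member of \<open>L\<close> contributes more than 1/2 to the sum of
    \<open>nuhat\<close>, which turns the Chang type bound into a bound on \<open>n\<close>.\<close>
  have "real n / 2 = (\<Sum>g\<in>L. 1 / 2)" by (simp add: n_def)
  also have "\<dots> \<le> (\<Sum>g\<in>L. nuhat g)" using L by (intro sum_mono) (auto simp: X_def)
  also have "\<dots> \<le> 2 * ln (card U / card S)" by (rule sum_nuhat_dissociated[OF finL L(2)])
  also have "real (card U) / card S = (of_int M / card A) ^ k" by (simp add: cardS cardU power_divide)
  also have "ln \<dots> = k * ln (of_int M / card A)" using M_pos a by (simp add: ln_realpow)
  finally have "n \<le> 4 * k * ln (of_int M / card A)" by simp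
  from rank[OF this] have qn: "int (q ^ n) < M"
    and osc: "8 * pi * sqrt (card B / card A) * n * l * of_int M \<le> card B * real q" by auto
  obtain h where h: "bij_betw h {..<n} L"
    using ex_bij_betw_nat_finite[OF finL] by (auto simp: n_def atLeast0LessThan)
  obtain d p where d: "0 < d" "d \<le> int (q ^ n)"
    and dp: "\<And>i. i < n \<Longrightarrow> \<bar>of_int d * (of_int (h i) / of_int M) - of_int (p i)\<bar> < 1 / q"
    using Dirichlet_approx_simult[OF q, of n "\<lambda>i. of_int (h i) / of_int M"] by blast
  have small_L: "norm (chi g d - 1) \<le> 2 * pi / q" if "g \<in> L" for g
  proof -
    obtain i where i: "i < n" "g = h i" using h \<open>g \<in> L\<close> by (auto simp: bij_betw_def)
    have "norm (chi g d - 1) \<le> 2 * pi * (1 / q)"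
      unfolding i(2) using dp[OF i(1)]
      by (intro order_trans[OF norm_chi_minus_1_le[of _ _ "p i"]] mult_left_mono) auto
    then show ?thesis by simp
  qed
  \<comment> \<open>There are \<open>n\<close> spanning frequencies, each moved by at most
    \<open>2 * pi / q\<close> per multiple of \<open>d\<close>, with fewer than \<open>l\<close>
    multiples.\<close>
  define w where "w = n * (l * (2 * pi / q))"
  have w_nonneg: "0 \<le> w" by (simp add: w_def)
  have small: "norm (chi g (int j * d) - 1) \<le> w" if g: "g \<in> Z" "1 / 2 < nuhat g" and j: "j < l" for g j
  proof -
    obtain e where "\<forall>h\<in>L. e h \<in> {-1, 0, 1}" "M dvd (g - (\<Sum>h\<in>L. e h * h))"
      using span[of g] g by (auto simp: X_def)
    then have "norm (chi g (int j * d) - 1) \<le> (\<Sum>h\<in>L. norm (chi h (int j * d) - 1))"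
      by (rule norm_chi_span_minus_1_le[OF finL])
    also have "\<dots> \<le> (\<Sum>h\<in>L. l * (2 * pi / q))"
    proof (rule sum_mono)
      fix h assume h: "h \<in> L"
      have "norm (chi h (int j * d) - 1) \<le> j * norm (chi h d - 1)" by (rule norm_chi_mult_minus_1_le)
      also have "\<dots> \<le> l * (2 * pi / q)" using j small_L[OF h] by (intro mult_mono) auto
      finally show "norm (chi h (int j * d) - 1) \<le> l * (2 * pi / q)" .
    qed
    finally show ?thesis by (simp add: w_def n_def)
  qed
  define beta where "beta = card B / real_of_int M"
  define kap where "kap = sqrt (card B / card A)"
  have kap_nonneg: "0 \<le> kap" by (simp add: kap_def)
  have smooth1: "kap * (2 * (1 / 2) ^ m) \<le> beta / 4"
    using smoothing M_pos by (simp add: beta_def kap_def field_simps power_divide)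
  have smooth2: "kap * w \<le> beta / 4"
    using osc M_pos q by (simp add: beta_def kap_def w_def field_simps)
  have osc: "\<bar>(P ^^ m) f (x + int j * d) - (P ^^ m) f x\<bar> \<le> beta / 2" if j: "j < l" for x j
  proof -
    let ?b = "popularity_coef A B"
    have four: "complex_of_real ((P ^^ m) f x) = (\<Sum>g\<in>Z. ?b g * of_real (nuhat g) ^ m * chi g x)" for x
      by (rule funpow_P_Fourier) (simp add: f_def popularity_Fourier[OF B])
    have "\<bar>(P ^^ m) f (x + int j * d) - (P ^^ m) f x\<bar>
        = norm (complex_of_real ((P ^^ m) f (x + int j * d)) - complex_of_real ((P ^^ m) f x))"
      by (simp flip: of_real_diff)
    also have "\<dots> = norm (\<Sum>g\<in>Z. ?b g * of_real (nuhat g) ^ m * chi g x * (chi g (int j * d) - 1))"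
      unfolding four chi_add by (simp add: algebra_simps flip: sum_subtractf)
    also have "\<dots> \<le> (\<Sum>g\<in>Z. norm (?b g) * (nuhat g ^ m * norm (chi g (int j * d) - 1)))"
      using nuhat_nonneg by (intro order_trans[OF norm_sum] sum_mono) (simp add: norm_mult norm_power)
    \<comment> \<open>Large spectrum: \<open>chi\<close> is within \<open>w\<close> of 1. Small
      spectrum: the factor \<open>nuhat g ^ m\<close> decays and the trivial distance 2
      suffices.\<close>
    also have "\<dots> \<le> (\<Sum>g\<in>Z. norm (?b g) * (2 * (1 / 2) ^ m + w))"
    proof (intro sum_mono mult_left_mono)
      fix g assume g: "g \<in> Z"
      show "nuhat g ^ m * norm (chi g (int j * d) - 1) \<le> 2 * (1 / 2) ^ m + w"
      proof (cases "1 / 2 < nuhat g")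
        case True
        have "nuhat g ^ m * norm (chi g (int j * d) - 1) \<le> 1 * w"
          using small[OF g True j] nuhat_nonneg nuhat_le_1 by (intro mult_mono power_le_one) auto
        then show ?thesis by (simp add: add_increasing)
      next
        case False
        have "norm (chi g (int j * d) - 1) \<le> 2"
          using norm_triangle_ineq4[of "chi g (int j * d)" 1] by simp
        then have "nuhat g ^ m * norm (chi g (int j * d) - 1) \<le> (1 / 2) ^ m * 2"
          using False nuhat_nonneg by (intro mult_mono power_mono) auto
        then show ?thesis using w_nonneg by simp
      qed
    qed simp
    also have "\<dots> \<le> kap * (2 * (1 / 2) ^ m + w)"
      unfolding sum_distrib_right[symmetric] kap_def using w_nonneg
      by (intro mult_right_mono sum_norm_popularity_coef A B) auto
    also have "\<dots> \<le> beta / 2" using smooth1 smooth2 by (simp add: algebra_simps)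
    finally show ?thesis .
  qed
  have "\<exists>x\<in>Z. \<forall>j<l. f (x + int j * d) \<noteq> 0"
  proof (rule ccontr)
    assume "\<not> ?thesis"
    then have "\<forall>x\<in>Z. \<exists>j<l. f (x + int j * d) = 0" by blast
    then obtain j where j: "\<And>x. x \<in> Z \<Longrightarrow> j x < l \<and> f (x + int (j x) * d) = 0" by metis
    define D where "D = (\<lambda>j. int j * d) ` {..<l}"
    have cD: "card D = l" using d by (simp add: D_def card_image inj_on_def)
    have "(\<Sum>x\<in>Z. (P ^^ m) f (x + int (j x) * d)) / of_int M \<le> 2 * m * ln (card D) / k"
    proof (rule walk_from_zeros[where F = F and D = D, OF F_shift F_mod f_avg f_nonneg k m mgf])
      show "finite D" by (simp add: D_def)
      show "int (j x) * d \<in> D \<and> f (x + int (j x) * d) = 0" if "x \<in> Z" for x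
        using j[OF that] by (auto simp: D_def)
    qed
    also have "\<dots> < beta / 2"
      using sampling k M_pos by (simp add: cD beta_def field_simps)
    finally have up: "(\<Sum>x\<in>Z. (P ^^ m) f (x + int (j x) * d)) / of_int M < beta / 2" .
    have "beta = (\<Sum>x\<in>Z. (P ^^ m) f x) / of_int M"
      using sum_funpow_P[of f m] f_mod sum_popularity[OF A B] by (simp add: beta_def f_def)
    also have "\<dots> \<le> (\<Sum>x\<in>Z. (P ^^ m) f (x + int (j x) * d) + beta / 2) / of_int M"
    proof (intro divide_right_mono sum_mono)
      show "(P ^^ m) f x \<le> (P ^^ m) f (x + int (j x) * d) + beta / 2" if "x \<in> Z" for x
        using osc[of "j x" x] j[OF that] by linarith
    qed (use M_pos in simp)
    also have "\<dots> = (\<Sum>x\<in>Z. (P ^^ m) f (x + int (j x) * d)) / of_int M + beta / 2"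
      using M_pos by (simp add: sum.distrib add_divide_distrib)
    finally show False using up by simp
  qed
  then obtain x where "\<forall>j<l. f (x + int j * d) \<noteq> 0" by blast
  then have "\<exists>y\<in>A. \<exists>z\<in>B. (x + int j * d) mod M = (y + z) mod M" if "j < l" for j
    using popularity_nonzero[of A B "x + int j * d"] that unfolding f_def by blast
  moreover have "d < M" using d qn by linarith
  ultimately show ?thesis using d by blast
qed

end

section \<open>Short progressions by pigeonhole\<close>

context cyclic_modulus
begin

text \<open>For short progressions one can take \<open>x\<close> with many representations \<open>x = y + z\<close>: if \<open>R\<close> is
  the set of the \<open>y\<close> that occur, then \<open>x + j * d \<in> A + B\<close> as soon as \<open>j * d \<in> R - R\<close>, and a common
  such \<open>d\<close> comes from two points of \<open>R ^ n\<close> on a line of direction \<open>(1, \<dots>, n)\<close>.\<close>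

lemma short_progression_mod:
  fixes A B :: "int set" and n :: nat
  assumes A: "A \<subseteq> Z" "A \<noteq> {}" and B: "B \<subseteq> Z" and n: "0 < n"
    and dense: "of_int M ^ (n - 1) < (real (card A) * card B / of_int M) ^ n"
  shows "\<exists>x d. 0 < d \<and> d < M \<and> (\<forall>j<n + 1. \<exists>y\<in>A. \<exists>z\<in>B. (x + int j * d) mod M = (y + z) mod M)"
proof -
  have finA: "finite A" using A finite_subset by auto
  then have a: "0 < card A" using A by (simp add: card_gt_0_iff)
  have "\<exists>x\<in>Z. card B / of_int M \<le> popularity A B x"
  proof (rule ccontr)
    assume "\<not> ?thesis"
    then have "(\<Sum>x\<in>Z. popularity A B x) < (\<Sum>x\<in>Z. card B / of_int M)"
      using M_pos by (intro sum_strict_mono) (force simp: not_le)+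
    then show False using M_pos sum_popularity[OF A B] by simp
  qed
  then obtain x where x: "card B / of_int M \<le> popularity A B x" by blast
  define R where "R = {y \<in> A. (x - y) mod M \<in> B}"
  have finR: "finite R" using finA by (simp add: R_def)
  have RZ: "R \<subseteq> Z" using A by (auto simp: R_def)
  have "(\<Sum>y\<in>A. residue_ind B (x - y)) = card R"
    using finA by (simp add: R_def residue_ind_def sum.If_cases Int_def)
  then have R: "real (card A) * card B / of_int M \<le> card R"
    using x a M_pos by (simp add: popularity_def field_simps)
  \<comment> \<open>\<open>g r\<close> records \<open>r\<close> modulo the line of direction (1,
    ..., n). Equal values force \<open>r j - s j\<close> to be congruent to
    \<open>(j + 1) * (r 0 - s 0)\<close>, and there are only \<open>M ^ (n - 1)\<close>
    values.\<close>
  define g where "g r = (\<lambda>j\<in>{1..<n}. (r j - int (j + 1) * r 0) mod M)" for r :: "nat \<Rightarrow> int"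
  have "of_int M ^ (n - 1) < real (card R) ^ n"
    using dense R M_pos by (intro less_le_trans[OF dense] power_mono) auto
  then have "real (nat M ^ (n - 1)) < real (card R ^ n)" using M_pos by simp
  then have "nat M ^ (n - 1) < card R ^ n" by (simp only: of_nat_less_iff)
  moreover have "card (PiE {1..<n} (\<lambda>_. Z)) = nat M ^ (n - 1)" by (simp add: card_PiE)
  moreover have "card (PiE {..<n} (\<lambda>_. R)) = card R ^ n" by (simp add: card_PiE)
  moreover have "g ` PiE {..<n} (\<lambda>_. R) \<subseteq> PiE {1..<n} (\<lambda>_. Z)"
    using M_pos unfolding g_def by (intro image_subsetI) (simp add: restrict_PiE_iff)
  moreover have "finite (PiE {1..<n} (\<lambda>_. Z))" by (intro finite_PiE) auto
  ultimately have "\<not> inj_on g (PiE {..<n} (\<lambda>_. R))"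
    using card_inj_on_le[of g "PiE {..<n} (\<lambda>_. R)" "PiE {1..<n} (\<lambda>_. Z)"] by linarith
  then obtain r s where r: "r \<in> PiE {..<n} (\<lambda>_. R)" and s: "s \<in> PiE {..<n} (\<lambda>_. R)"
    and rs: "r \<noteq> s" "g r = g s" by (auto simp: inj_on_def)
  have rR: "r j \<in> R" and sR: "s j \<in> R" if "j < n" for j using r s that by auto
  define d where "d = (r 0 - s 0) mod M"
  have diff: "(int (j + 1) * d) mod M = (r j - s j) mod M" if j: "j < n" for j
  proof (cases "j = 0")
    case False
    then have "(r j - int (j + 1) * r 0) mod M = (s j - int (j + 1) * s 0) mod M"
      using fun_cong[OF rs(2), of j] j by (simp add: g_def)
    then have "M dvd (r j - int (j + 1) * r 0) - (s j - int (j + 1) * s 0)"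
      by (simp only: mod_eq_dvd_iff)
    also have "(r j - int (j + 1) * r 0) - (s j - int (j + 1) * s 0)
        = (r j - s j) - int (j + 1) * (r 0 - s 0)" by (simp add: algebra_simps)
    finally have "(r j - s j) mod M = (int (j + 1) * (r 0 - s 0)) mod M"
      by (simp only: mod_eq_dvd_iff)
    then show ?thesis unfolding d_def by (simp only: mod_mult_right_eq)
  qed (simp add: d_def)
  have "d \<noteq> 0"
  proof
    assume d0: "d = 0"
    have "r j = s j" for j
    proof (cases "j < n")
      case True
      then have "M dvd (r j - s j)" using diff[OF True] d0 by (simp add: dvd_eq_mod_eq_0)
      then show ?thesis using dvd_diff_iff_eq[of "r j" "s j"] rR[OF True] sR[OF True] RZ by blast
    qed (use r s in \<open>auto simp: PiE_def extensional_def\<close>)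
    then show False using rs by auto
  qed
  then have d: "0 < d" "d < M" using pos_mod_bound[OF M_pos, of "r 0 - s 0"] pos_mod_sign[OF M_pos, of "r 0 - s 0"]
    unfolding d_def by linarith+
  \<comment> \<open>The term at \<open>j = 0\<close> is \<open>x\<close> itself; for
    \<open>j = i + 1\<close> the summand from \<open>A\<close> is \<open>r i\<close> and the one
    from \<open>B\<close> is \<open>x - s i\<close>.\<close>
  have "\<exists>y\<in>A. \<exists>z\<in>B. (x + int j * d) mod M = (y + z) mod M" if j: "j < n + 1" for j
  proof (cases j)
    case 0
    have "x mod M = (r 0 + (x - r 0) mod M) mod M" by (simp add: mod_simps)
    then show ?thesis using rR[of 0] n 0 by (auto simp: R_def)
  next
    case (Suc i)
    then have i: "i < n" using j by simp
    have "(x + int j * d) mod M = (x + (r i - s i) mod M) mod M"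
      using diff[OF i] Suc by (metis Suc_eq_plus1 mod_add_right_eq)
    also have "\<dots> = (r i + (x - s i) mod M) mod M" by (simp add: mod_simps algebra_simps)
    finally show ?thesis using rR[OF i] sR[OF i] by (auto simp: R_def)
  qed
  then show ?thesis using d by blast
qed

end

section \<open>From residues back to natural numbers\<close>

text \<open>All sums lie in {2..2N}, shorter than half the modulus \<open>4 * N\<close>, so a
  difference of two of them is determined by its residue. This rules out wrap-around and makes the
  representatives a genuine progression.\<close>

lemma arith_progression_of_residues:
  fixes A B :: "nat set" and N l :: nat and x d :: int
  assumes A: "A \<subseteq> {1..N}" and B: "B \<subseteq> {1..N}" and l: "0 < l"
    and d: "0 < d" "d < 4 * int N"
    and prog: "\<And>j. j < l \<Longrightarrow> \<exists>y\<in>int ` A. \<exists>z\<in>int ` B. (x + int j * d) mod (4 * int N) = (y + z) mod (4 * int N)"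
  shows "\<exists>P. arith_progression l P \<and> P \<subseteq> A + B"
proof -
  let ?M = "4 * int N"
  have "\<exists>r. r \<in> A + B \<and> 2 \<le> r \<and> r \<le> 2 * N \<and> (x + int j * d) mod ?M = int r mod ?M" if j: "j < l" for j
  proof -
    obtain y z where yz: "y \<in> A" "z \<in> B" "(x + int j * d) mod ?M = (int y + int z) mod ?M"
      using prog[OF j] by auto
    moreover have "1 \<le> y" "y \<le> N" "1 \<le> z" "z \<le> N" using A B yz by auto
    ultimately show ?thesis by (intro exI[of _ "y + z"]) auto
  qed
  then obtain r where r: "\<And>j. j < l \<Longrightarrow> r j \<in> A + B \<and> 2 \<le> r j \<and> r j \<le> 2 * N
      \<and> (x + int j * d) mod ?M = int (r j) mod ?M" by metis
  \<comment> \<open>The representative of \<open>d\<close> of least absolute value. If it is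
    negative, the progression is read from its last term backwards.\<close>
  define e where "e = (if d \<le> 2 * int N then d else d - ?M)"
  have e: "- (2 * int N) < e" "e \<le> 2 * int N" "e \<noteq> 0" using d by (auto simp: e_def)
  have step: "int (r (Suc j)) - int (r j) = e" if j: "Suc j < l" for j
  proof -
    have rj: "2 \<le> r j" "r j \<le> 2 * N" "2 \<le> r (Suc j)" "r (Suc j) \<le> 2 * N" using r[of j] r[of "Suc j"] j by auto
    have "(int (r (Suc j)) - int (r j)) mod ?M = (int (r (Suc j)) mod ?M - int (r j) mod ?M) mod ?M"
      by (simp add: mod_simps)
    also have "\<dots> = ((x + int (Suc j) * d) mod ?M - (x + int j * d) mod ?M) mod ?M"
      using r[of j] r[of "Suc j"] j by simp
    also have "\<dots> = d mod ?M" by (simp add: mod_simps algebra_simps)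
    also have "\<dots> = e mod ?M" by (simp add: e_def)
    finally have "?M dvd (int (r (Suc j)) - int (r j) - e)" by (simp only: mod_eq_dvd_iff)
    moreover have "\<bar>int (r (Suc j)) - int (r j) - e\<bar> < ?M" using rj e by linarith
    ultimately have "int (r (Suc j)) - int (r j) - e = 0"
      using dvd_imp_le_int[of "int (r (Suc j)) - int (r j) - e" ?M] by (meson abs_ge_self leD order_trans)
    then show ?thesis by simp
  qed
  have rj: "int (r j) = int (r 0) + int j * e" if "j < l" for j
    using that
  proof (induction j)
    case (Suc j)
    then show ?case using step[of j] by (simp add: ring_distribs)
  qed simp
  show ?thesis
  proof (cases "0 < e")
    case True
    have "r 0 + i * nat e = r i" if "i < l" for i
    proof -
      have "int (r 0 + i * nat e) = int (r i)" using rj[OF that] True by simp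
      then show ?thesis by (simp only: of_nat_eq_iff)
    qed
    then have "(\<lambda>i. r 0 + i * nat e) ` {..<l} \<subseteq> A + B" using r by auto
    moreover have "arith_progression l ((\<lambda>i. r 0 + i * nat e) ` {..<l})"
      unfolding arith_progression_def using True by (intro exI[of _ "r 0"] exI[of _ "nat e"]) auto
    ultimately show ?thesis by blast
  next
    case False
    then have neg: "e < 0" using e by simp
    have "r (l - 1) + i * nat (- e) = r (l - 1 - i)" if "i < l" for i
    proof -
      have "int (r (l - 1) + i * nat (- e)) = int (r (l - 1 - i))"
        using rj[of "l - 1"] rj[of "l - 1 - i"] that neg l by (simp add: of_nat_diff algebra_simps)
      then show ?thesis by (simp only: of_nat_eq_iff)
    qed
    moreover have "r (l - 1 - i) \<in> A + B" if "i < l" for i using r[of "l - 1 - i"] that by simp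
    ultimately have "(\<lambda>i. r (l - 1) + i * nat (- e)) ` {..<l} \<subseteq> A + B" by auto
    moreover have "arith_progression l ((\<lambda>i. r (l - 1) + i * nat (- e)) ` {..<l})"
      unfolding arith_progression_def using neg by (intro exI[of _ "r (l - 1)"] exI[of _ "nat (- e)"]) auto
    ultimately show ?thesis by blast
  qed
qed

section \<open>Choice of parameters\<close>

lemma nat_ceiling_le: "0 \<le> x \<Longrightarrow> real (nat \<lceil>x\<rceil>) \<le> x + 1" for x :: real
  using of_int_ceiling_le_add_one[of x] by simp

lemma le_exp_half_power: "exp (real m / 2) \<le> 2 ^ m"
proof -
  have "exp (1 / 2 :: real) ^ m \<le> 2 ^ m"
  proof (rule power_mono)
    have "(exp (1 / 2 :: real))\<^sup>2 \<le> 2\<^sup>2" using exp_le by (simp flip: exp_double)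
    then show "exp (1 / 2 :: real) \<le> 2" by (rule power2_le_imp_le) simp
  qed simp
  then show ?thesis by (simp flip: exp_of_nat_mult)
qed

text \<open>The target bound, squared and stated for an integer \<open>l\<close>. Using
  \<open>1 + ln (1 / \<alpha>)\<close> instead of \<open>ln (1 / \<alpha>)\<close> lets one
  \<open>Q\<close> serve all \<open>\<alpha> < 1\<close>.\<close>

lemma progression_of_large_parameters:
  fixes c1 c2 :: real
  assumes c1: "0 < c1" and c2: "0 < c2"
  shows "\<exists>Q>0. \<forall>(N::nat) (\<alpha>::real) (A::nat set) (B::nat set) l.
    0 < N \<longrightarrow> 0 < \<alpha> \<longrightarrow> \<alpha> < 1 \<longrightarrow> A \<subseteq> {1..N} \<longrightarrow> B \<subseteq> {1..N} \<longrightarrow>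
    c1 * \<alpha> * real N \<le> real (card A) \<longrightarrow> card A \<le> card B \<longrightarrow> real (card B) \<le> c2 * \<alpha> * real N \<longrightarrow>
    3 \<le> l \<longrightarrow> Q * (ln (real l))\<^sup>2 * (1 + ln (1 / \<alpha>))\<^sup>2 \<le> \<alpha> * ln (real N) \<longrightarrow>
    (\<exists>P. arith_progression l P \<and> P \<subseteq> A + B)"
proof -
  \<comment> \<open>Roles: \<open>sk\<close> bounds \<open>sqrt (card B / card A)\<close>;
    \<open>K\<close> bounds \<open>ln (M / card A)\<close> by \<open>K * (1 + lam)\<close>;
    \<open>2 ^ m\<close> must reach \<open>E1 / \<alpha>\<close>; \<open>K1\<close>,
    \<open>K2\<close>, \<open>K3\<close> bound \<open>m\<close>, \<open>k\<close> and the rank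
    \<open>n\<close>; \<open>K4\<close> fixes \<open>q\<close>; \<open>ln q \<le> K5 * ln l\<close>.
    In \<open>Q\<close>, \<open>K3 * K5\<close> serves long progressions and \<open>2 * K\<close>
    short ones.\<close>
  define sk where "sk = sqrt (c2 / c1)"
  define K where "K = max 1 (ln (4 / c1))"
  define E1 where "E1 = max 1 (32 * sk / c1)"
  define K1 where "K1 = 2 * ln E1 + 4"
  define K2 where "K2 = 16 * K1 / c1 + 1"
  define K3 where "K3 = 4 * K2 * K"
  define K4 where "K4 = 32 * pi * sk * K3 / c1"
  define K5 where "K5 = ln (K4 + 1) + 6"
  define Q where "Q = max (K3 * K5) (2 * K)"
  have sk: "0 < sk" using c1 c2 by (simp add: sk_def)
  have K: "1 \<le> K" by (simp add: K_def)
  have E1: "1 \<le> E1" by (simp add: E1_def)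
  have K1: "4 \<le> K1" using E1 by (simp add: K1_def)
  have K2: "1 \<le> K2" using c1 K1 by (simp add: K2_def)
  have K3: "0 < K3" using K K2 by (simp add: K3_def)
  have K4: "0 < K4" using K3 sk c1 by (simp add: K4_def)
  have K5: "6 \<le> K5" using K4 by (simp add: K5_def)
  have Q: "0 < Q" using K by (simp add: Q_def)
  moreover have "\<exists>P. arith_progression l P \<and> P \<subseteq> A + B"
    if N: "0 < N" and \<alpha>: "0 < \<alpha>" "\<alpha> < 1" and A: "A \<subseteq> {1..N}" and B: "B \<subseteq> {1..N}"
      and cA: "c1 * \<alpha> * real N \<le> real (card A)" and AB: "card A \<le> card B"
      and cB: "real (card B) \<le> c2 * \<alpha> * real N"
      and l: "3 \<le> l" and large: "Q * (ln (real l))\<^sup>2 * (1 + ln (1 / \<alpha>))\<^sup>2 \<le> \<alpha> * ln (real N)"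
    for N l :: nat and \<alpha> :: real and A B
  proof -
    define M where "M = 4 * int N"
    define lam where "lam = ln (1 / \<alpha>)"
    define A' where "A' = int ` A"
    define B' where "B' = int ` B"
    have card': "card A' = card A" "card B' = card B" by (simp_all add: A'_def B'_def card_image)
    have M: "real_of_int M = 4 * real N" by (simp add: M_def)
    have Mpos: "0 < real_of_int M" using N M by simp
    interpret cyclic_modulus M by unfold_locales (use N in \<open>simp add: M_def\<close>)
    have A'Z: "A' \<subseteq> Z" and B'Z: "B' \<subseteq> Z" using A B by (auto simp: A'_def B'_def M_def)
    have "0 < c1 * \<alpha> * real N" using c1 \<alpha> N by simp
    then have a: "0 < card A" using cA by linarith
    then have b: "0 < card B" using AB by simp
    have A'_ne: "A' \<noteq> {}" using a card' by auto
    have lam: "0 < lam" using \<alpha> by (simp add: lam_def)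
    have inv_\<alpha>: "1 / \<alpha> = exp lam" using \<alpha> by (simp add: lam_def)
    have lnl: "1 \<le> ln (real l)"
      using l exp_le by (subst ln_ge_iff) auto
    have Ma: "of_int M / card A \<le> 4 / (c1 * \<alpha>)"
      using cA a c1 \<alpha> N by (simp add: M field_simps)
    have Mb: "of_int M / card B \<le> 4 / (c1 * \<alpha>)"
    proof -
      have "of_int M / card B \<le> of_int M / card A"
        using AB a Mpos by (intro divide_left_mono) auto
      then show ?thesis using Ma by simp
    qed
    have lnK: "ln (4 / (c1 * \<alpha>)) \<le> K * (1 + lam)"
    proof -
      have "ln (4 / (c1 * \<alpha>)) = ln (4 / c1) + lam"
        using c1 \<alpha> by (simp add: lam_def ln_div ln_mult)
      also have "\<dots> \<le> K + K * lam"
        using K lam by (intro add_mono) (auto simp: K_def)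
      finally show ?thesis by (simp add: algebra_simps)
    qed
    have sqrt_le: "sqrt (card B / card A) \<le> sk"
    proof -
      have "card B / card A \<le> (c2 * \<alpha> * real N) / (c1 * \<alpha> * real N)"
        using cA cB c1 \<alpha> N b by (intro frac_le) auto
      also have "\<dots> = c2 / c1" using \<alpha> N by simp
      finally show ?thesis by (simp add: sk_def)
    qed
    \<comment> \<open>The order of magnitude of the rank, that is of \<open>k\<close> times
      \<open>ln (M / card A)\<close>.\<close>
    define V where "V = (1 + lam)\<^sup>2 * ln l / \<alpha>"
    have V_large: "Q * (ln l * V) \<le> ln (real N)"
      using large \<alpha> by (simp add: V_def lam_def field_simps power2_eq_square)
    have ln_N: "ln (real N) < ln (of_int M)" using N by (simp add: M)
    have one_le: "1 \<le> (1 + lam) * ln l / \<alpha>"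
    proof -
      have "1 * 1 \<le> (1 + lam) * ln l" using lam lnl by (intro mult_mono) auto
      then show ?thesis using \<alpha> by (simp add: field_simps)
    qed
    have V: "1 \<le> V"
    proof -
      have "1 * 1 \<le> (1 + lam) * ((1 + lam) * ln l / \<alpha>)" using lam one_le by (intro mult_mono) auto
      then show ?thesis by (simp add: V_def power2_eq_square mult.assoc)
    qed
    have "\<exists>x d. 0 < d \<and> d < M \<and> (\<forall>j<l. \<exists>y\<in>A'. \<exists>z\<in>B'. (x + int j * d) mod M = (y + z) mod M)"
    \<comment> \<open>For \<open>l\<close> above \<open>1 / \<alpha>\<close> the precision
      \<open>q\<close> is polynomial in \<open>l\<close>, so Dirichlet's theorem is affordable;
      otherwise the pigeonhole argument applies.\<close>
    proof (cases "1 / \<alpha> < real l")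
      case True
      define m where "m = nat \<lceil>2 * (ln E1 + lam)\<rceil> + 1"
      have m_lower: "2 * (ln E1 + lam) \<le> m" unfolding m_def by linarith
      have m_upper: "m \<le> K1 * (1 + lam)"
      proof -
        have "0 \<le> 2 * (ln E1 + lam)" using E1 lam by simp
        from nat_ceiling_le[OF this] have "m \<le> 2 * (ln E1 + lam) + 1 + 1"
          by (simp only: m_def of_nat_add of_nat_1 add_le_cancel_right)
        also have "\<dots> \<le> K1 + K1 * lam"
        proof -
          have "4 * lam \<le> K1 * lam" using K1 lam by (intro mult_right_mono) auto
          moreover have "2 * ln E1 = K1 - 4" by (simp add: K1_def)
          ultimately show ?thesis using lam by argo
        qed
        finally show ?thesis by (simp add: algebra_simps)
      qed
      \<comment> \<open>Floor plus one gives the strict inequality demanded by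
        \<open>sampling\<close>.\<close>
      define k where "k = nat \<lfloor>4 * m * ln l * (of_int M / card B)\<rfloor> + 1"
      have k_arg: "0 \<le> 4 * m * ln l * (of_int M / card B)" using lnl Mpos by simp
      have k_lower: "4 * m * ln l * (of_int M / card B) < k" unfolding k_def by linarith
      have k_upper: "k \<le> K2 * ((1 + lam) * ln l / \<alpha>)"
      proof -
        have "k \<le> 4 * m * ln l * (of_int M / card B) + 1" unfolding k_def using k_arg by linarith
        also have "\<dots> \<le> 4 * (K1 * (1 + lam)) * ln l * (4 / (c1 * \<alpha>)) + (1 + lam) * ln l / \<alpha>"
          using m_upper Mb one_le lnl Mpos K1 lam
          by (intro add_mono mult_mono) auto
        also have "\<dots> = K2 * ((1 + lam) * ln l / \<alpha>)"
          using c1 \<alpha> by (simp add: K2_def field_simps)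
        finally show ?thesis .
      qed
      define q where "q = nat \<lceil>K4 * V * l / \<alpha>\<rceil>"
      have q_arg: "0 < K4 * V * l / \<alpha>" using K4 V l \<alpha> by simp
      have q_lower: "K4 * V * l / \<alpha> \<le> q" unfolding q_def by linarith
      then have q_pos: "0 < q" using q_arg by linarith
      \<comment> \<open>Here \<open>1 / \<alpha> < l\<close> enters: \<open>1 + lam\<close>,
        \<open>ln l\<close> and \<open>1 / \<alpha>\<close> are all at most \<open>l\<close>, hence
        \<open>V \<le> l ^ 4\<close> and \<open>q\<close> is of order \<open>l ^ 6\<close>.\<close>
      have ln_q: "ln q \<le> K5 * ln l"
      proof -
        have "1 + lam \<le> 1 / \<alpha>" unfolding inv_\<alpha> by (rule exp_ge_add_one_self)
        then have lam_l: "1 + lam \<le> l" using True by simp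
        have "ln l \<le> l" using l ln_le_minus_one[of "real l"] by simp
        then have "V \<le> (real l)\<^sup>2 * real l * real l"
          unfolding V_def divide_inverse using lam_l lam lnl True \<alpha>
          by (intro mult_mono power_mono) (auto simp: divide_inverse)
        then have "K4 * V * l / \<alpha> \<le> K4 * ((real l)\<^sup>2 * real l * real l) * real l * real l"
          unfolding divide_inverse using K4 V True \<alpha>
          by (intro mult_mono) (auto simp: divide_inverse)
        also have "\<dots> = K4 * real l ^ 6" by (simp add: eval_nat_numeral)
        finally have "K4 * V * l / \<alpha> \<le> K4 * real l ^ 6" .
        then have "q \<le> K4 * real l ^ 6 + 1"
          unfolding q_def using nat_ceiling_le[of "K4 * V * l / \<alpha>"] q_arg by linarith
        also have "\<dots> \<le> (K4 + 1) * real l ^ 6" using l by (simp add: algebra_simps)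
        finally have "ln q \<le> ln ((K4 + 1) * real l ^ 6)" using q_pos by (subst ln_le_cancel_iff) auto
        also have "\<dots> = ln (K4 + 1) * 1 + 6 * ln l"
          using K4 l by (simp add: ln_mult ln_realpow)
        also have "\<dots> \<le> ln (K4 + 1) * ln l + 6 * ln l"
          using K4 lnl by (intro add_mono mult_left_mono) auto
        finally show ?thesis by (simp add: K5_def algebra_simps)
      qed
      show ?thesis
      proof (rule progression_mod[OF A'Z A'_ne B'Z, where k = k and m = m and q = q])
        show "0 < k" "0 < m" "0 < q" "0 < l" using q_pos l by (auto simp: k_def m_def)
        show "8 * sqrt (card B' / card A') * of_int M \<le> 2 ^ m * card B'"
        proof -
          have "8 * sqrt (card B / card A) * (of_int M / card B) \<le> 8 * sk * (4 / (c1 * \<alpha>))"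
            using sqrt_le Mb sk Mpos by (intro mult_mono) auto
          also have "\<dots> = 32 * sk / c1 * exp lam" by (simp flip: inv_\<alpha>)
          also have "\<dots> \<le> E1 * exp lam" by (intro mult_right_mono) (auto simp: E1_def)
          also have "\<dots> = exp (ln E1 + lam)" using E1 by (simp add: exp_add)
          also have "\<dots> \<le> exp (m / 2)" using m_lower by simp
          also have "\<dots> \<le> 2 ^ m" by (rule le_exp_half_power)
          finally show ?thesis using b by (simp add: card' field_simps)
        qed
        show "4 * m * ln l * of_int M < k * card B'"
          using k_lower b by (simp add: card' field_simps)
      next
        fix n :: nat
        assume "n \<le> 4 * k * ln (of_int M / card A')"
        also have "\<dots> \<le> 4 * (K2 * ((1 + lam) * ln l / \<alpha>)) * (K * (1 + lam))"
        proof (intro mult_mono)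
          have "ln (of_int M / card A) \<le> ln (4 / (c1 * \<alpha>))"
            using Ma a Mpos c1 \<alpha> by (subst ln_le_cancel_iff) auto
          then show "ln (of_int M / card A') \<le> K * (1 + lam)" using lnK by (simp add: card')
          have "card A \<le> N" using card_mono[OF _ A] by simp
          then have "1 \<le> of_int M / card A" using a by (simp add: M)
          then show "0 \<le> ln (of_int M / card A')" by (simp add: card')
        qed (use k_upper K2 one_le in auto)
        also have "\<dots> = K3 * V" by (simp add: K3_def V_def power2_eq_square)
        finally have n: "n \<le> K3 * V" .
        have "ln (real (q ^ n)) = n * ln q" using q_pos by (simp add: ln_realpow)
        also have "\<dots> \<le> (K3 * V) * (K5 * ln l)"
          using n ln_q q_pos K3 V by (intro mult_mono) auto
        also have "\<dots> = (K3 * K5) * (ln l * V)" by simp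
        also have "\<dots> \<le> Q * (ln l * V)"
          using V lnl by (intro mult_right_mono) (auto simp: Q_def)
        also have "\<dots> < ln (of_int M)" using V_large ln_N by simp
        finally have "real (q ^ n) < real_of_int M" using q_pos Mpos by (subst (asm) ln_less_cancel_iff) auto
        then have "int (q ^ n) < M" by linarith
        moreover have "8 * pi * sqrt (card B / card A) * n * l * (of_int M / card B) \<le> q"
        proof -
          have "8 * pi * sqrt (card B / card A) * n * l * (of_int M / card B)
              \<le> 8 * pi * sk * (K3 * V) * l * (4 / (c1 * \<alpha>))"
            using sqrt_le n Mb Mpos sk K3 V by (intro mult_mono) auto
          also have "\<dots> = K4 * V * l / \<alpha>" by (simp add: K4_def)
          finally show ?thesis using q_lower by linarith
        qed
        ultimately show "int (q ^ n) < M \<and>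
            8 * pi * sqrt (card B' / card A') * n * l * of_int M \<le> card B' * real q"
          using b by (simp add: card' pos_divide_le_eq mult.commute)
      qed
    next
      case False
      \<comment> \<open>\<open>short_progression_mod\<close> yields \<open>n + 1\<close>
        terms.\<close>
      define n where "n = l - 1"
      have n: "0 < n" "n + 1 = l" using l by (auto simp: n_def)
      have "of_int M ^ (n - 1) < (real (card A') * card B' / of_int M) ^ n"
      proof -
        \<comment> \<open>A common bound for \<open>M / card A\<close> and
          \<open>M / card B\<close>; it reduces the density condition to
          \<open>t ^ (2 * n) < M\<close>.\<close>
        define t where "t = 4 / (c1 * \<alpha>)"
        have t: "0 < t" using c1 \<alpha> by (simp add: t_def)
        have lnK: "ln t \<le> K * (1 + lam)" using lnK by (simp only: t_def)
        have "(2 * n) * ln t \<le> (2 * (1 / \<alpha>)) * (K * (1 + lam))"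
        proof (cases "0 \<le> ln t")
          case True
          show ?thesis using lnK True False n \<alpha> by (intro mult_mono) auto
        next
          case neg: False
          have "(2 * n) * ln t \<le> 0" using neg by (simp add: mult_nonneg_nonpos)
          also have "0 \<le> (2 * (1 / \<alpha>)) * (K * (1 + lam))" using \<alpha> K lam by simp
          finally show ?thesis .
        qed
        also have "\<dots> \<le> (2 * K) * (ln l * V)"
        proof -
          have "1 * 1 * 1 \<le> (1 + lam) * ln l * ln l" using lam lnl by (intro mult_mono) auto
          then have "(2 * K * (1 + lam) / \<alpha>) * 1 \<le> (2 * K * (1 + lam) / \<alpha>) * ((1 + lam) * ln l * ln l)"
            using K lam \<alpha> by (intro mult_left_mono) auto
          moreover have "(2 * K) * (ln l * V) = (2 * K * (1 + lam) / \<alpha>) * ((1 + lam) * ln l * ln l)"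
            by (simp only: V_def power2_eq_square divide_inverse mult_ac)
          ultimately show ?thesis by simp
        qed
        also have "\<dots> \<le> Q * (ln l * V)"
          using V lnl by (intro mult_right_mono) (auto simp: Q_def)
        also have "\<dots> < ln (of_int M)" using V_large ln_N by simp
        finally have "ln (t ^ (2 * n)) < ln (of_int M)" using t by (simp add: ln_realpow)
        then have "t ^ (2 * n) < of_int M" using t Mpos by (subst (asm) ln_less_cancel_iff) auto
        then have "t ^ (2 * n) * of_int M ^ (n - 1) < of_int M * of_int M ^ (n - 1)"
          using Mpos by (intro mult_strict_right_mono) auto
        also have "\<dots> = of_int M ^ n" using n by (simp flip: power_Suc)
        finally have "of_int M ^ (n - 1) < of_int M ^ n / t ^ (2 * n)"
          by (subst pos_less_divide_eq[OF zero_less_power[OF t]]) (simp only: mult.commute)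
        also have "\<dots> = (of_int M / t * (1 / t)) ^ n"
          by (simp only: power_mult power2_eq_square power_mult_distrib power_divide) (simp add: field_simps)
        also have "\<dots> \<le> (real (card A) * (card B / of_int M)) ^ n"
        proof (intro power_mono mult_mono)
          show "of_int M / t \<le> card A" using Ma a t unfolding t_def[symmetric] by (simp add: pos_divide_le_eq mult.commute)
          show "1 / t \<le> card B / of_int M" using Mb b t Mpos unfolding t_def[symmetric] by (simp add: field_simps)
        qed (use Mpos t in auto)
        finally show ?thesis by (simp add: card')
      qed
      then show ?thesis using short_progression_mod[OF A'Z A'_ne B'Z n(1)] n(2) by simp
    qed
    then obtain x d where "0 < d" "d < M" "\<And>j. j < l \<Longrightarrow> \<exists>y\<in>A'. \<exists>z\<in>B'. (x + int j * d) mod M = (y + z) mod M"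
      by blast
    then show ?thesis
      using arith_progression_of_residues[OF A B, of l d x] l by (auto simp: M_def A'_def B'_def)
  qed
  ultimately show ?thesis by blast
qed

text \<open>Serves the range where the claimed length is at most 2: two elements of \<open>B\<close>
  are shifted by one element of \<open>A\<close>.\<close>

lemma two_term_progression:
  fixes A B :: "nat set"
  assumes A: "A \<noteq> {}" and B: "2 \<le> card B"
  shows "\<exists>P. arith_progression 2 P \<and> P \<subseteq> A + B"
proof -
  obtain a where a: "a \<in> A" using A by blast
  obtain C where "C \<subseteq> B" "card C = 2" by (rule obtain_subset_with_card_n[OF B])
  then obtain x y where "x \<in> B" "y \<in> B" "x \<noteq> y" by (auto simp: card_2_iff)
  then obtain x y where b: "x \<in> B" "y \<in> B" "x < y" by (metis nat_neq_iff)
  have "(\<lambda>i. (a + x) + i * (y - x)) ` {..<2} = {a + x, a + y}"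
    using b by (auto simp: numeral_2_eq_2 lessThan_Suc)
  moreover have "{a + x, a + y} \<subseteq> A + B" using a b by (simp add: set_plus_intro)
  ultimately show ?thesis
    unfolding arith_progression_def using b
    by (intro exI[of _ "{a + x, a + y}"] conjI exI[of _ "a + x"] exI[of _ "y - x"]) auto
qed

text \<open>Since \<open>\<alpha> \<le> \<alpha>0\<close>, \<open>ln (1 / \<alpha>)\<close> is
  bounded below by \<open>lam0 > 0\<close>, so \<open>1 + ln (1 / \<alpha>)\<close> is at most a
  constant times \<open>ln (1 / \<alpha>)\<close>. This converts the condition with \<open>Q\<close>
  into one on \<open>density_factor\<close>.\<close>

theorem theorem1p2:
  fixes \<alpha>0 c1 c2 :: real
  assumes "0 < \<alpha>0" and "\<alpha>0 < 1" and "0 < c1" and "0 < c2"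
  shows "\<exists>c>0. \<forall>(N::nat) (\<alpha>::real) (A::nat set) (B::nat set).
           0 < N \<longrightarrow> 0 < \<alpha> \<longrightarrow> \<alpha> \<le> \<alpha>0 \<longrightarrow>
           A \<subseteq> {1..N} \<longrightarrow> B \<subseteq> {1..N} \<longrightarrow>
           c1 * \<alpha> * real N \<le> real (card A) \<longrightarrow>
           card A \<le> card B \<longrightarrow>
           real (card B) \<le> c2 * \<alpha> * real N \<longrightarrow>
           2 \<le> card B \<longrightarrow>
           (\<exists>k P. arith_progression k P \<and> P \<subseteq> A + B \<and>
                  exp (c * density_factor \<alpha> * sqrt (ln (real N))) \<le> real k)"
proof -
  obtain Q where Q: "0 < Q" and prog: "\<And>N \<alpha> A B l. \<lbrakk>0 < N; 0 < \<alpha>; \<alpha> < 1; A \<subseteq> {1..N}; B \<subseteq> {1..N};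
      c1 * \<alpha> * real N \<le> real (card A); card A \<le> card B; real (card B) \<le> c2 * \<alpha> * real N;
      3 \<le> l; Q * (ln (real l))\<^sup>2 * (1 + ln (1 / \<alpha>))\<^sup>2 \<le> \<alpha> * ln (real N)\<rbrakk>
      \<Longrightarrow> \<exists>P. arith_progression l P \<and> P \<subseteq> A + B"
    using progression_of_large_parameters[OF assms(3,4)] by blast
  define lam0 where "lam0 = ln (1 / \<alpha>0)"
  have lam0: "0 < lam0" using assms by (simp add: lam0_def)
  \<comment> \<open>Chosen so that \<open>c_sq\<close> holds, which cancels all constants in the
    final estimate; the 2 pays for rounding \<open>E\<close> up to an integer.\<close>
  define c where "c = 1 / (2 * sqrt Q * (1 + 1 / lam0))"
  have c: "0 < c" using Q lam0 by (simp add: c_def add_pos_pos)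
  have c_sq: "4 * c\<^sup>2 * (Q * (1 + 1 / lam0)\<^sup>2) = 1"
  proof -
    have "2 * c * (sqrt Q * (1 + 1 / lam0)) = 1"
      using Q lam0 by (simp add: c_def add_pos_pos less_imp_neq[symmetric])
    then have "(2 * c * (sqrt Q * (1 + 1 / lam0)))\<^sup>2 = 1" by simp
    then show ?thesis using Q by (simp add: power_mult_distrib)
  qed
  have "\<exists>k P. arith_progression k P \<and> P \<subseteq> A + B \<and>
      exp (c * density_factor \<alpha> * sqrt (ln (real N))) \<le> real k"
    if N: "0 < N" and \<alpha>: "0 < \<alpha>" "\<alpha> \<le> \<alpha>0" and A: "A \<subseteq> {1..N}" and B: "B \<subseteq> {1..N}"
      and cA: "c1 * \<alpha> * real N \<le> real (card A)" and AB: "card A \<le> card B"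
      and cB: "real (card B) \<le> c2 * \<alpha> * real N" and B2: "2 \<le> card B"
    for N :: nat and \<alpha> :: real and A B :: "nat set"
  proof -
    define lam where "lam = ln (1 / \<alpha>)"
    have lam: "lam0 \<le> lam" unfolding lam_def lam0_def using \<alpha> assms by (simp add: frac_le)
    then have lam_pos: "0 < lam" using lam0 by simp
    have \<alpha>1: "\<alpha> < 1" using \<alpha> assms by simp
    define E where "E = exp (c * density_factor \<alpha> * sqrt (ln (real N)))"
    show ?thesis
    proof (cases "E \<le> 2")
      case True
      have "0 < c1 * \<alpha> * real N" using assms \<alpha> N by simp
      then have "A \<noteq> {}" using cA by auto
      then obtain P where "arith_progression 2 P" "P \<subseteq> A + B" using two_term_progression B2 by blast
      then show ?thesis using True unfolding E_def by (intro exI[of _ 2] exI[of _ P]) auto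
    next
      case False
      define l where "l = nat \<lceil>E\<rceil>"
      have El: "E \<le> l" unfolding l_def by linarith
      have l3: "3 \<le> l" using False unfolding l_def by linarith
      \<comment> \<open>Rounding up at most doubles the logarithm, because
        \<open>E > 2\<close>.\<close>
      have "real l \<le> E * E"
      proof -
        have "real l \<le> E + 1" unfolding l_def using nat_ceiling_le False by simp
        also have "\<dots> \<le> 2 * E" using False by simp
        also have "\<dots> \<le> E * E" using False by (intro mult_right_mono) auto
        finally show ?thesis .
      qed
      then have "ln (real l) \<le> ln (E * E)" using l3 by (subst ln_le_cancel_iff) (auto simp: E_def)
      also have "\<dots> = 2 * (c * density_factor \<alpha> * sqrt (ln (real N)))"
        by (simp add: E_def ln_mult)
      also have "\<dots> = 2 * c * (sqrt (\<alpha> * ln N) / lam)"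
        using \<alpha> by (simp add: density_factor_def lam_def powr_half_sqrt real_sqrt_mult)
      finally have lnl: "ln (real l) \<le> 2 * c * (sqrt (\<alpha> * ln N) / lam)" .
      have "(ln (real l))\<^sup>2 \<le> (2 * c * (sqrt (\<alpha> * ln N) / lam))\<^sup>2"
        using lnl l3 by (intro power_mono) auto
      also have "\<dots> = 4 * c\<^sup>2 * (\<alpha> * ln N / lam\<^sup>2)"
        using \<alpha> N by (simp add: power_mult_distrib power_divide)
      finally have sq: "(ln (real l))\<^sup>2 \<le> 4 * c\<^sup>2 * (\<alpha> * ln N / lam\<^sup>2)" .
      have "1 + lam \<le> lam * (1 + 1 / lam0)"
        using lam lam0 by (simp add: field_simps)
      then have "(1 + lam)\<^sup>2 \<le> (lam * (1 + 1 / lam0))\<^sup>2" using lam_pos by (intro power_mono) auto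
      then have "Q * (ln (real l))\<^sup>2 * (1 + lam)\<^sup>2
          \<le> Q * (4 * c\<^sup>2 * (\<alpha> * ln N / lam\<^sup>2)) * (lam * (1 + 1 / lam0))\<^sup>2"
        using sq Q \<alpha> N by (intro mult_mono) auto
      also have "\<dots> = (4 * c\<^sup>2 * (Q * (1 + 1 / lam0)\<^sup>2)) * (\<alpha> * ln N)"
        using lam_pos by (simp add: power_mult_distrib)
      also have "\<dots> = \<alpha> * ln N" by (simp only: c_sq mult_1_left)
      finally have "Q * (ln (real l))\<^sup>2 * (1 + ln (1 / \<alpha>))\<^sup>2 \<le> \<alpha> * ln (real N)"
        by (simp only: lam_def)
      then obtain P where "arith_progression l P" "P \<subseteq> A + B"
        using prog[OF N \<alpha>(1) \<alpha>1 A B cA AB cB l3] by blast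
      then show ?thesis using El unfolding E_def by blast
    qed
  qed
  then show ?thesis using c by (intro exI[of _ c]) blast
qed

end
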